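(* Let $d\ge 1$ be an integer and suppose that the functions $a_j,b_j$ ($j=1,\dots,d$) and $c$ belong to the space $UC_b(\mathbb{R}^d)$ endowed with the norm $\|f\|=\sup_{x\in\mathbb{R}^d}|f(x)|$; put $b=(b_1,\dots,b_d)$. Let the operator $H$ be defined on the domain $C_b^\infty(\mathbb{R}^d)\subset UC_b(\mathbb{R}^d)$ by $$(H\varphi)(x)=\sum_{j=1}^d (a_j(x))^2\,\varphi''_{x_jx_j}(x)+\langle b(x),\nabla\varphi(x)\rangle+c(x)\varphi(x).$$ Suppose that the closure of this operator a) exists, and b) is an infinitesimal generator of a $C_0$-semigroup $(e^{tH})_{t\ge 0}$ in $UC_b(\mathbb{R}^d)$. For $t\ge 0$, $x\in\mathbb{R}^d$ and a bounded continuous function $f\colon\mathbb{R}^d\to\mathbb{R}$ define $$(S(t)f)(x)=\frac{1}{4d}\sum_{j=1}^d\Big(f\big(x+2\sqrt d\,a_j(x)\sqrt t\,e_j\big)+f\big(x-2\sqrt d\,a_j(x)\sqrt t\,e_j\big)\Big)+\frac12 f(x+2t\,b(x))+t\,c(x)f(x),$$ where $e_j\in\mathbb{R}^d$ is the vector with $1$ at position $j$ and $0$ at the other $d-1$ positions. Then for each $u_0\in UC_b(\mathbb{R}^d)$ there exists a bounded (and uniformly continuous with respect to $x\in\mathbb{R}^d$ for each $t\ge 0$) solution $u\colon[0,+\infty)\times\mathbb{R}^d\to\mathbb{R}$ of the Cauchy problem $$u'_t(t,x)=\sum_{j=1}^d (a_j(x))^2u''_{x_jx_j}(t,x)+\langle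 b(x),\nabla u(t,x)\rangle+c(x)u(t,x),\qquad u(0,x)=u_0(x),$$ and it depends on $u_0$ continuously and uniformly with respect to $x\in\mathbb{R}^d$ for each $t\ge 0$. For each $x\in\mathbb{R}^d$ and $t\ge 0$ this solution is given by the formula $$u(t,x)=\big(e^{tH}u_0\big)(x)=\lim_{n\to\infty}\Big(\big(S(t/n)\big)^n u_0\Big)(x),$$ where $S(t/n)$ is obtained by substituting $t/n$ for $t$ in the definition of $S(t)$, and $(S(t/n))^n$ means the composition of $n$ copies of the linear bounded operator $S(t/n)$. For each fixed $t>0$ the limit is taken in the space $UC_b(\mathbb{R}^d)$, and it is uniform with respect to $t\in[0,t_0]$ for each $t_0>0$.
   Context: $UC_b(\mathbb{R}^d)$ is the Banach space of all bounded, uniformly continuous functions $f\colon\mathbb{R}^d\to\mathbb{R}$ with the uniform norm $\|f\|=\sup_{x\in\mathbb{R}^d}|f(x)|$. $C_b^\infty(\mathbb{R}^d)$ is the set of all bounded real-valued functions on $\mathbb{R}^d$ with bounded derivatives of all orders. $\langle\cdot,\cdot\rangle$ is the scalar product in $\mathbb{R}^d$, and $\nabla$ is the gradient with respect to $x$. A $C_0$-semigroup is a strongly continuous one-parameter semigroup of bounded linear operators; $(e^{tH})_{t\ge 0}$ denotes the one generated by the closure of $(H,C_b^\infty(\mathbb{R}^d))$.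
   Formalization: "Solution" means mild solution of u'=Hu for the closure of H (classical if u_0 is in its domain), as for a=0 and constant b the function u_0(x+tb) need not be differentiable; "bounded" means bounded on [0,t_0]×R^d for each t_0>0, as a=b=0, c=1 gives e^t. *)

theory Defs
  imports "HOL-Analysis.Analysis"
begin

typedef (overloaded) ('a::metric_space) ucbfun =
  "{f :: 'a \<Rightarrow> real. bounded (range f) \<and> uniformly_continuous_on UNIV f}"
  morphisms apply_ucbfun Ucbfun
  by (rule exI[of _ "\<lambda>_. 0"]) (auto simp: image_def intro: uniformly_continuous_on_const)

declare [[coercion "apply_ucbfun :: 'a::metric_space ucbfun \<Rightarrow> 'a \<Rightarrow> real"]]

setup_lifting type_definition_ucbfun

lemma bounded_apply_ucbfun [simp, intro]: "bounded (range (apply_ucbfun f))"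
  and ucont_apply_ucbfun [simp, intro]: "uniformly_continuous_on UNIV (apply_ucbfun f)"
  using apply_ucbfun[of f] by auto

lemma ucbfun_eqI: "(\<And>x. apply_ucbfun f x = apply_ucbfun g x) \<Longrightarrow> f = g"
  by transfer auto

lemma bounded_range_mult:
  fixes f g :: "'a \<Rightarrow> real"
  assumes "bounded (range f)" "bounded (range g)"
  shows "bounded (range (\<lambda>x. f x * g x))"
proof -
  obtain B C where "\<And>x. \<bar>f x\<bar> \<le> B" "\<And>x. \<bar>g x\<bar> \<le> C"
    using assms by (auto simp: bounded_iff)
  then have "\<bar>f x * g x\<bar> \<le> B * C" for x
    unfolding abs_mult by (meson abs_ge_zero mult_mono order_trans)
  then show ?thesis by (auto simp: bounded_iff)
qed

lemma bounded_range_sum: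
  fixes f :: "'i \<Rightarrow> 'a \<Rightarrow> real"
  assumes "\<And>i. i \<in> I \<Longrightarrow> bounded (range (f i))"
  shows "bounded (range (\<lambda>x. \<Sum>i\<in>I. f i x))"
  using assms
proof (induction I rule: infinite_finite_induct)
  case (insert i I)
  then show ?case by (simp add: bounded_plus_comp)
qed (simp_all add: image_def)

lemma ucont_mult:
  fixes f g :: "'a::metric_space \<Rightarrow> real"
  assumes bf: "bounded (range f)" and bg: "bounded (range g)"
    and f: "uniformly_continuous_on UNIV f" and g: "uniformly_continuous_on UNIV g"
  shows "uniformly_continuous_on UNIV (\<lambda>x. f x * g x)"
proof -
  obtain B C where B: "\<And>x. \<bar>f x\<bar> \<le> B" and C: "\<And>x. \<bar>g x\<bar> \<le> C"
    using bf bg by (auto simp: bounded_iff)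
  define K where "K = max 1 (max B C)"
  have K: "K > 0" "\<And>x. \<bar>f x\<bar> \<le> K" "\<And>x. \<bar>g x\<bar> \<le> K"
    using B C by (auto simp: K_def le_max_iff_disj)
  show ?thesis
    unfolding uniformly_continuous_on_def
  proof (intro allI impI)
    fix e :: real assume "e > 0"
    then have e: "e / (2 * K) > 0" using K by simp
    obtain d1 where d1: "d1 > 0" "\<And>x y. dist y x < d1 \<Longrightarrow> dist (f y) (f x) < e / (2 * K)"
      using f e unfolding uniformly_continuous_on_def by (meson UNIV_I)
    obtain d2 where d2: "d2 > 0" "\<And>x y. dist y x < d2 \<Longrightarrow> dist (g y) (g x) < e / (2 * K)"
      using g e unfolding uniformly_continuous_on_def by (meson UNIV_I)
    have "dist (f y * g y) (f x * g x) < e" if "dist y x < min d1 d2" for x y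
    proof -
      have "\<bar>f y * g y - f x * g x\<bar> = \<bar>f y * (g y - g x) + g x * (f y - f x)\<bar>"
        by (simp add: algebra_simps)
      also have "\<dots> \<le> \<bar>f y\<bar> * \<bar>g y - g x\<bar> + \<bar>g x\<bar> * \<bar>f y - f x\<bar>"
        by (metis abs_mult abs_triangle_ineq)
      also have "\<dots> \<le> K * \<bar>g y - g x\<bar> + K * \<bar>f y - f x\<bar>"
        using K by (intro add_mono mult_right_mono) auto
      also have "\<dots> < K * (e / (2 * K)) + K * (e / (2 * K))"
        using K d1(2)[of y x] d2(2)[of y x] that
        by (intro add_strict_mono mult_strict_left_mono) (auto simp: dist_real_def)
      also have "\<dots> = e" using K by (simp add: field_simps)
      finally show ?thesis by (simp add: dist_real_def)
    qed
    then show "\<exists>d>0. \<forall>x\<in>UNIV. \<forall>x'\<in>UNIV. dist x' x < d \<longrightarrow> dist (f x' * g x') (f x * g x) < e"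
      using d1 d2 by (intro exI[of _ "min d1 d2"]) auto
  qed
qed

instantiation ucbfun :: (metric_space) real_vector
begin

lift_definition zero_ucbfun :: "'a ucbfun" is "\<lambda>_. 0"
  by (auto simp: image_def intro: uniformly_continuous_on_const)

lift_definition plus_ucbfun :: "'a ucbfun \<Rightarrow> 'a ucbfun \<Rightarrow> 'a ucbfun" is "\<lambda>f g x. f x + g x"
  by (auto intro: bounded_plus_comp uniformly_continuous_on_add)

lift_definition minus_ucbfun :: "'a ucbfun \<Rightarrow> 'a ucbfun \<Rightarrow> 'a ucbfun" is "\<lambda>f g x. f x - g x"
  by (auto intro: bounded_minus_comp uniformly_continuous_on_diff)

lift_definition uminus_ucbfun :: "'a ucbfun \<Rightarrow> 'a ucbfun" is "\<lambda>f x. - f x"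
  by (auto simp: bounded_iff intro: uniformly_continuous_on_minus)

lift_definition scaleR_ucbfun :: "real \<Rightarrow> 'a ucbfun \<Rightarrow> 'a ucbfun" is "\<lambda>r f x. r * f x"
  by (intro conjI ucont_mult bounded_range_mult uniformly_continuous_on_const)
     (auto simp: image_def)

instance
  by standard (transfer; simp add: algebra_simps fun_eq_iff)+

end

lemmas ucbfun_rep_eq [simp] =
  zero_ucbfun.rep_eq plus_ucbfun.rep_eq minus_ucbfun.rep_eq uminus_ucbfun.rep_eq
  scaleR_ucbfun.rep_eq

instantiation ucbfun :: (metric_space) real_normed_vector
begin

lift_definition norm_ucbfun :: "'a ucbfun \<Rightarrow> real" is "\<lambda>f. SUP x. \<bar>f x\<bar>" .

definition dist_ucbfun :: "'a ucbfun \<Rightarrow> 'a ucbfun \<Rightarrow> real"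
  where "dist_ucbfun f g = norm (f - g)"

definition sgn_ucbfun :: "'a ucbfun \<Rightarrow> 'a ucbfun"
  where "sgn_ucbfun f = f /\<^sub>R norm f"

definition uniformity_ucbfun :: "('a ucbfun \<times> 'a ucbfun) filter"
  where "uniformity_ucbfun = (INF e\<in>{0 <..}. principal {(x, y). dist x y < e})"

definition open_ucbfun :: "'a ucbfun set \<Rightarrow> bool"
  where "open_ucbfun S = (\<forall>x\<in>S. \<forall>\<^sub>F (x', y) in uniformity. x' = x \<longrightarrow> y \<in> S)"

lemma abs_le_norm_ucbfun: "\<bar>apply_ucbfun f x\<bar> \<le> norm f"
  for f :: "'a ucbfun"
proof transfer
  fix f :: "'a \<Rightarrow> real" and x
  assume "bounded (range f) \<and> uniformly_continuous_on UNIV f"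
  then obtain B where "\<And>y. \<bar>f y\<bar> \<le> B" by (auto simp: bounded_iff)
  then show "\<bar>f x\<bar> \<le> (SUP x. \<bar>f x\<bar>)"
    by (intro cSUP_upper bdd_aboveI2) auto
qed

lemma norm_ucbfun_le: "(\<And>x. \<bar>apply_ucbfun f x\<bar> \<le> B) \<Longrightarrow> norm f \<le> B"
  for f :: "'a ucbfun"
  by transfer (auto intro!: cSUP_least)

instance
proof
  fix f g :: "'a ucbfun" and r :: real
  have nonneg: "norm h \<ge> 0" for h :: "'a ucbfun"
    using abs_le_norm_ucbfun[of h undefined] by linarith
  show "norm f = 0 \<longleftrightarrow> f = 0"
  proof
    assume "norm f = 0"
    then show "f = 0"
      using abs_le_norm_ucbfun[of f] by (intro ucbfun_eqI) simp
  next
    assume "f = 0"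
    then have "norm f \<le> 0" by (intro norm_ucbfun_le) simp
    then show "norm f = 0" using nonneg[of f] by linarith
  qed
  show "norm (f + g) \<le> norm f + norm g"
  proof (rule norm_ucbfun_le)
    fix x show "\<bar>apply_ucbfun (f + g) x\<bar> \<le> norm f + norm g"
      using abs_le_norm_ucbfun[of f x] abs_le_norm_ucbfun[of g x] by simp
  qed
  have le: "norm (s *\<^sub>R h) \<le> \<bar>s\<bar> * norm h" for s and h :: "'a ucbfun"
    by (rule norm_ucbfun_le) (auto simp: abs_mult intro!: mult_left_mono abs_le_norm_ucbfun)
  show "norm (r *\<^sub>R f) = \<bar>r\<bar> * norm f"
  proof (cases "r = 0")
    case True
    then show ?thesis using le[of r f] nonneg[of "r *\<^sub>R f"] by simp
  next
    case False
    then have "norm f \<le> inverse \<bar>r\<bar> * norm (r *\<^sub>R f)"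
      using le[of "inverse r" "r *\<^sub>R f"] by simp
    then have "\<bar>r\<bar> * norm f \<le> norm (r *\<^sub>R f)"
      using False by (simp add: field_simps)
    with le[of r f] show ?thesis by linarith
  qed
qed (simp_all add: dist_ucbfun_def sgn_ucbfun_def uniformity_ucbfun_def open_ucbfun_def)

end

instance ucbfun :: (metric_space) banach
proof
  fix X :: "nat \<Rightarrow> 'a ucbfun"
  assume "Cauchy X"
  have pw: "dist (apply_ucbfun f x) (apply_ucbfun g x) \<le> dist f g" for f g :: "'a ucbfun" and x
    using abs_le_norm_ucbfun[of "f - g" x] by (simp add: dist_norm)
  have "\<forall>e>0. \<exists>M. \<forall>m\<ge>M. \<forall>n\<ge>M. \<forall>x. True \<longrightarrow> dist (X m x) (X n x) < e"
    using \<open>Cauchy X\<close> unfolding Cauchy_def by (meson pw le_less_trans)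
  then obtain g where g: "\<forall>e>0. \<exists>N. \<forall>n\<ge>N. \<forall>x. True \<longrightarrow> dist (X n x) (g x) < e"
    using uniformly_convergent_eq_cauchy[of "\<lambda>_. True" "\<lambda>n. apply_ucbfun (X n)"] by metis
  obtain N where N: "\<And>x. dist (X N x) (g x) < 1"
    using g[rule_format, of 1] by auto
  have "\<bar>g x\<bar> \<le> norm (X N) + 1" for x
    using N[of x] abs_le_norm_ucbfun[of "X N" x] by (simp add: dist_real_def)
  then have bg: "bounded (range g)" by (auto simp: bounded_iff)
  have ug: "uniformly_continuous_on UNIV g"
    unfolding uniformly_continuous_on_def
  proof (intro allI impI)
    fix e :: real assume "e > 0"
    then have "e / 3 > 0" by simp
    then obtain N where N: "\<And>x. dist (X N x) (g x) < e / 3"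
      using g[rule_format, of "e / 3"] by auto
    obtain d where d: "d > 0" "\<And>x y. dist y x < d \<Longrightarrow> dist (X N y) (X N x) < e / 3"
      using ucont_apply_ucbfun[of "X N"] \<open>e / 3 > 0\<close>
      unfolding uniformly_continuous_on_def by (meson UNIV_I)
    have "dist (g y) (g x) < e" if "dist y x < d" for x y
      using N[of x] N[of y] d(2)[OF that] unfolding dist_real_def by linarith
    with d show "\<exists>d>0. \<forall>x\<in>UNIV. \<forall>x'\<in>UNIV. dist x' x < d \<longrightarrow> dist (g x') (g x) < e"
      by auto
  qed
  have G: "apply_ucbfun (Ucbfun g) = g"
    using bg ug by (simp add: Ucbfun_inverse)
  have "X \<longlonglongrightarrow> Ucbfun g"
  proof (rule metric_LIMSEQ_I)
    fix e :: real assume "e > 0"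
    then obtain N where N: "\<And>n x. n \<ge> N \<Longrightarrow> dist (X n x) (g x) < e / 2"
      using g[rule_format, of "e / 2"] by auto
    have "dist (X n) (Ucbfun g) < e" if "n \<ge> N" for n
    proof -
      have "norm (X n - Ucbfun g) \<le> e / 2"
        using N[OF that] by (intro norm_ucbfun_le) (simp add: G dist_real_def less_imp_le)
      then show ?thesis using \<open>e > 0\<close> by (simp add: dist_norm)
    qed
    then show "\<exists>N. \<forall>n\<ge>N. dist (X n) (Ucbfun g) < e" by blast
  qed
  then show "convergent X" by (rule convergentI)
qed

lemma bounded_linear_apply_ucbfun: "bounded_linear (\<lambda>f. apply_ucbfun f x)"
  by (rule bounded_linear_intro[where K = 1]) (auto simp: abs_le_norm_ucbfun)

text \<open>Unbounded operators on a Banach space are represented by their graphs, so that the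
  closure of an operator is the topological closure of its graph.\<close>

definition closable :: "('a::real_normed_vector \<times> 'a) set \<Rightarrow> bool"
  where "closable A \<longleftrightarrow> single_valued (closure A)"

definition C0_semigroup :: "(real \<Rightarrow> 'a::real_normed_vector \<Rightarrow>\<^sub>L 'a) \<Rightarrow> bool"
  where "C0_semigroup T \<longleftrightarrow>
    T 0 = id_blinfun \<and>
    (\<forall>s\<ge>0. \<forall>t\<ge>0. T (s + t) = T s o\<^sub>L T t) \<and>
    (\<forall>x. continuous_on {0..} (\<lambda>t. T t x))"

definition generator :: "(real \<Rightarrow> 'a::real_normed_vector \<Rightarrow>\<^sub>L 'a) \<Rightarrow> ('a \<times> 'a) set"
  where "generator T = {(x, y). ((\<lambda>h. (T h x - x) /\<^sub>R h) \<longlongrightarrow> y) (at_right 0)}"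

definition classical_solution ::
    "('a::banach \<times> 'a) set \<Rightarrow> 'a \<Rightarrow> (real \<Rightarrow> 'a) \<Rightarrow> bool"
  where "classical_solution A u0 u \<longleftrightarrow>
    u 0 = u0 \<and>
    (\<exists>v. continuous_on {0..} v \<and>
      (\<forall>t\<ge>0. (u t, v t) \<in> A \<and> (u has_vector_derivative v t) (at t within {0..})))"

definition mild_solution ::
    "('a::banach \<times> 'a) set \<Rightarrow> 'a \<Rightarrow> (real \<Rightarrow> 'a) \<Rightarrow> bool"
  where "mild_solution A u0 u \<longleftrightarrow>
    u 0 = u0 \<and> continuous_on {0..} u \<and>
    (\<forall>t\<ge>0. (integral {0..t} u, u t - u0) \<in> A)"

definition partial :: "'n::finite \<Rightarrow> (real^'n \<Rightarrow> real) \<Rightarrow> real^'n \<Rightarrow> real"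
  where "partial j f x = deriv (\<lambda>s. f (x + s *\<^sub>R axis j 1)) 0"

definition gradient :: "(real^'n::finite \<Rightarrow> real) \<Rightarrow> real^'n \<Rightarrow> real^'n"
  where "gradient f x = (\<chi> j. partial j f x)"

text \<open>The function itself and all its iterated partial derivatives (indexed by lists of
  directions) are everywhere differentiable and bounded.\<close>

definition Cb_infty :: "(real^'n::finite \<Rightarrow> real) set"
  where "Cb_infty = {f. \<forall>js. (\<forall>x. foldr partial js f differentiable (at x)) \<and>
                          bounded (range (foldr partial js f))}"

definition diff_expr ::
    "('n::finite \<Rightarrow> (real^'n) ucbfun) \<Rightarrow> ('n \<Rightarrow> (real^'n) ucbfun) \<Rightarrow> (real^'n) ucbfun \<Rightarrow>
     (real^'n \<Rightarrow> real) \<Rightarrow> real^'n \<Rightarrow> real"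
  where "diff_expr a b c \<phi> x =
    (\<Sum>j\<in>UNIV. (a j x)\<^sup>2 * partial j (partial j \<phi>) x)
    + (\<chi> j. b j x) \<bullet> gradient \<phi> x + c x * \<phi> x"

definition diff_op ::
    "('n::finite \<Rightarrow> (real^'n) ucbfun) \<Rightarrow> ('n \<Rightarrow> (real^'n) ucbfun) \<Rightarrow> (real^'n) ucbfun \<Rightarrow>
     ((real^'n) ucbfun \<times> (real^'n) ucbfun) set"
  where "diff_op a b c =
    {(\<phi>, \<psi>). apply_ucbfun \<phi> \<in> Cb_infty \<and> apply_ucbfun \<psi> = diff_expr a b c \<phi>}"

lemma Cb_infty_partial: "f \<in> Cb_infty \<Longrightarrow> partial j f \<in> Cb_infty"
  unfolding Cb_infty_def
proof (safe, goal_cases)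
  case (1 js x)
  then have "foldr partial (js @ [j]) f differentiable (at x)" by blast
  then show ?case by simp
next
  case (2 js)
  then have "bounded (range (foldr partial (js @ [j]) f))" by blast
  then show ?case by simp
qed

lemma Cb_inftyD:
  assumes "f \<in> Cb_infty"
  shows "f differentiable (at x)" "bounded (range f)"
  using assms unfolding Cb_infty_def by (auto dest: spec[of _ "[]"])

lemma partial_eq_frechet:
  assumes "(f has_derivative f') (at x)"
  shows "partial j f x = f' (axis j 1)"
proof -
  have 1: "((\<lambda>s::real. x + s *\<^sub>R axis j (1::real)) has_derivative (\<lambda>s. s *\<^sub>R axis j 1)) (at 0)"
    by (auto intro!: derivative_eq_intros)
  have 2: "(f has_derivative f') (at (x + (0::real) *\<^sub>R axis j (1::real)))"
    using assms by simp
  have "((\<lambda>s. f (x + s *\<^sub>R axis j 1)) has_derivative (\<lambda>s. f' (s *\<^sub>R axis j 1))) (at 0)"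
    using diff_chain_at[OF 1 2] by (simp add: o_def)
  then have "((\<lambda>s. f (x + s *\<^sub>R axis j 1)) has_derivative (\<lambda>s. f' (axis j 1) * s)) (at 0)"
    using linear_scale[OF has_derivative_linear[OF assms]] by (simp add: mult.commute)
  then show ?thesis
    unfolding partial_def by (intro DERIV_imp_deriv) (simp add: has_field_derivative_def)
qed

lemma Cb_infty_ucont:
  assumes "f \<in> Cb_infty"
  shows "uniformly_continuous_on UNIV f"
proof -
  have "\<forall>j. \<exists>B. \<forall>x. \<bar>partial j f x\<bar> \<le> B"
    using Cb_inftyD(2)[OF Cb_infty_partial[OF assms]] by (auto simp: bounded_iff)
  then obtain B where B: "\<And>j x. \<bar>partial j f x\<bar> \<le> B j" by metis
  obtain f' where f': "\<And>x. (f has_derivative f' x) (at x)"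
    using Cb_inftyD(1)[OF assms] unfolding differentiable_def by metis
  define K where "K = (\<Sum>j\<in>UNIV. B j)"
  have B0: "0 \<le> B j" for j using B[of j undefined] by linarith
  have "onorm (f' x) \<le> K" for x
  proof (rule onorm_le)
    fix h
    have "f' x h = f' x (\<Sum>j\<in>UNIV. (h $ j) *\<^sub>R axis j 1)"
      by (simp add: basis_expansion[of h, unfolded scalar_mult_eq_scaleR])
    also have "\<dots> = (\<Sum>j\<in>UNIV. (h $ j) * partial j f x)"
      using has_derivative_linear[OF f'[of x]]
      by (simp add: linear_sum linear_scale partial_eq_frechet[OF f'])
    also have "\<bar>\<dots>\<bar> \<le> (\<Sum>j\<in>UNIV. norm h * B j)"
    proof (rule order_trans[OF sum_abs], rule sum_mono)
      fix j show "\<bar>h $ j * partial j f x\<bar> \<le> norm h * B j"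
        unfolding abs_mult using component_le_norm_cart[of h j] B[of j x] B0[of j]
        by (intro mult_mono) auto
    qed
    finally show "norm (f' x h) \<le> K * norm h"
      by (simp add: K_def sum_distrib_left mult.commute)
  qed
  then have L: "norm (f x - f y) \<le> K * norm (x - y)" for x y
    using differentiable_bound[of UNIV f f' K] f' by auto
  have "K \<ge> 0" unfolding K_def using B0 by (intro sum_nonneg)
  then have "K-lipschitz_on UNIV f"
    using L by (auto simp: lipschitz_on_def dist_norm)
  then show ?thesis by (rule lipschitz_on_uniformly_continuous)
qed

lemma Cb_infty_ucbfun: "f \<in> Cb_infty \<Longrightarrow> \<exists>\<phi>. apply_ucbfun \<phi> = f"
  by (metis (mono_tags, lifting) Cb_inftyD(2) Cb_infty_ucont Ucbfun_inverse mem_Collect_eq)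

text \<open>The operator maps all of \<open>Cb_infty\<close> into the space, so the requirement that the value be
  an element of the space does not shrink the domain in \<^const>\<open>diff_op\<close>.\<close>

lemma diff_op_total:
  assumes "f \<in> Cb_infty"
  shows "\<exists>\<phi> \<psi>. apply_ucbfun \<phi> = f \<and> (\<phi>, \<psi>) \<in> diff_op a b c"
proof -
  have p: "bounded (range (partial j f)) \<and> uniformly_continuous_on UNIV (partial j f)"
    and pp: "bounded (range (partial j (partial j f))) \<and>
      uniformly_continuous_on UNIV (partial j (partial j f))" for j
    using assms by (auto intro!: Cb_infty_partial Cb_infty_ucont Cb_inftyD)
  have "bounded (range (diff_expr a b c f)) \<and> uniformly_continuous_on UNIV (diff_expr a b c f)"
    unfolding diff_expr_def gradient_def inner_vec_def power2_eq_square
    using p pp Cb_inftyD(2)[OF assms] Cb_infty_ucont[OF assms]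
    by (auto intro!: bounded_plus_comp bounded_range_sum bounded_range_mult
        uniformly_continuous_on_add uniformly_continuous_on_sum ucont_mult)
  then have "apply_ucbfun (Ucbfun (diff_expr a b c f)) = diff_expr a b c f"
    by (simp add: Ucbfun_inverse)
  then show ?thesis
    using Cb_infty_ucbfun[OF assms] assms unfolding diff_op_def by auto
qed

text \<open>The initial value problem for \<open>u'\<^sub>t = H u\<close> is understood as the abstract Cauchy
  problem for the closure of the operator: without any regularity of the initial value the
  solution need not be differentiable in \<open>t\<close> or \<open>x\<close> (take all \<open>a j = 0\<close>) and is a mild one;
  for initial values in the domain of the closure it is in addition classical.\<close>

definition solves_cauchy_problem ::
    "('n::finite \<Rightarrow> (real^'n) ucbfun) \<Rightarrow> ('n \<Rightarrow> (real^'n) ucbfun) \<Rightarrow> (real^'n) ucbfun \<Rightarrow>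
     (real^'n) ucbfun \<Rightarrow> (real \<Rightarrow> real^'n \<Rightarrow> real) \<Rightarrow> bool"
  where "solves_cauchy_problem a b c u0 u \<longleftrightarrow>
    (\<exists>U. (\<forall>t\<ge>0. apply_ucbfun (U t) = u t) \<and>
      mild_solution (closure (diff_op a b c)) u0 U \<and>
      (u0 \<in> Domain (closure (diff_op a b c)) \<longrightarrow>
        classical_solution (closure (diff_op a b c)) u0 U))"

text \<open>Wherever a classical solution is smooth in \<open>x\<close>, the partial differential equation holds
  pointwise.\<close>

lemma classical_solution_pointwise:
  assumes "closable (diff_op a b c)"
    and "classical_solution (closure (diff_op a b c)) u0 U"
    and t: "t \<ge> 0" and sm: "apply_ucbfun (U t) \<in> Cb_infty"
  shows "((\<lambda>s. U s x) has_real_derivative diff_expr a b c (U t) x) (at t within {0..})"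
proof -
  obtain v where v: "(U t, v) \<in> closure (diff_op a b c)"
      "(U has_vector_derivative v) (at t within {0..})"
    using assms(2) t unfolding classical_solution_def by blast
  obtain \<phi> \<psi> where \<psi>: "apply_ucbfun \<phi> = U t" "(\<phi>, \<psi>) \<in> diff_op a b c"
    using diff_op_total[OF sm] by blast
  then have "\<phi> = U t" by (simp add: apply_ucbfun_inject)
  then have "(U t, \<psi>) \<in> closure (diff_op a b c)"
    using \<psi> closure_subset by blast
  then have "v = \<psi>"
    using v(1) assms(1) unfolding closable_def by (meson single_valuedD)
  then have "v x = diff_expr a b c (U t) x"
    using \<psi> unfolding diff_op_def by auto
  then show ?thesis
    using bounded_linear.has_vector_derivative[OF bounded_linear_apply_ucbfun[of x] v(2)]
    by (simp add: has_real_derivative_iff_has_vector_derivative)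
qed

definition shift_expr ::
    "('n::finite \<Rightarrow> (real^'n) ucbfun) \<Rightarrow> ('n \<Rightarrow> (real^'n) ucbfun) \<Rightarrow> (real^'n) ucbfun \<Rightarrow>
     real \<Rightarrow> (real^'n \<Rightarrow> real) \<Rightarrow> real^'n \<Rightarrow> real"
  where "shift_expr a b c t f x =
    1 / (4 * real CARD('n)) *
      (\<Sum>j\<in>UNIV. f (x + (2 * sqrt (real CARD('n)) * a j x * sqrt t) *\<^sub>R axis j 1)
              + f (x - (2 * sqrt (real CARD('n)) * a j x * sqrt t) *\<^sub>R axis j 1))
    + 1 / 2 * f (x + (2 * t) *\<^sub>R (\<chi> j. b j x)) + t * c x * f x"

lemma ucont_scaleR_const:
  fixes f :: "'a::metric_space \<Rightarrow> real" and v :: "'b::real_normed_vector"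
  assumes "uniformly_continuous_on UNIV f"
  shows "uniformly_continuous_on UNIV (\<lambda>x. f x *\<^sub>R v)"
  by (rule bounded_linear.uniformly_continuous_on[OF bounded_linear_scaleR_left assms])

lemma ucont_shift:
  fixes f :: "real^'n::finite \<Rightarrow> real" and g :: "real^'n \<Rightarrow> real^'n"
  assumes "bounded (range f)" "uniformly_continuous_on UNIV f" "uniformly_continuous_on UNIV g"
  shows "bounded (range (\<lambda>x. f (g x))) \<and> uniformly_continuous_on UNIV (\<lambda>x. f (g x))"
proof
  show "bounded (range (\<lambda>x. f (g x)))"
    using assms(1) by (rule bounded_subset) auto
  show "uniformly_continuous_on UNIV (\<lambda>x. f (g x))"
    unfolding uniformly_continuous_on_def
  proof (intro allI impI)
    fix e :: real assume "e > 0"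
    then obtain d where d: "d > 0" "\<And>x y. dist y x < d \<Longrightarrow> dist (f y) (f x) < e"
      using assms(2) unfolding uniformly_continuous_on_def by (meson UNIV_I)
    obtain d' where "d' > 0" "\<And>x y. dist y x < d' \<Longrightarrow> dist (g y) (g x) < d"
      using assms(3) d(1) unfolding uniformly_continuous_on_def by (meson UNIV_I)
    then show "\<exists>d>0. \<forall>x\<in>UNIV. \<forall>x'\<in>UNIV. dist x' x < d \<longrightarrow> dist (f (g x')) (f (g x)) < e"
      using d(2) by (intro exI[of _ d']) auto
  qed
qed

lemma ucont_vec:
  fixes b :: "'n::finite \<Rightarrow> (real^'n) ucbfun"
  shows "uniformly_continuous_on UNIV (\<lambda>x. (\<chi> j. b j x))"
proof -
  have "(\<lambda>x. (\<chi> j. b j x)) = (\<lambda>x. \<Sum>j\<in>UNIV. b j x *\<^sub>R axis j 1)"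
    by (auto simp: vec_eq_iff axis_def if_distrib cong: if_cong)
  then show ?thesis
    by (auto intro!: uniformly_continuous_on_sum ucont_scaleR_const)
qed

lemma shift_expr_ucb:
  fixes a b :: "'n::finite \<Rightarrow> (real^'n) ucbfun"
  assumes "bounded (range f)" "uniformly_continuous_on UNIV f"
  shows "bounded (range (shift_expr a b c t f)) \<and>
    uniformly_continuous_on UNIV (shift_expr a b c t f)"
proof -
  have 1: "uniformly_continuous_on UNIV
      (\<lambda>x. (2 * sqrt (real CARD('n)) * a j x * sqrt t) *\<^sub>R axis j (1::real))" for j
    by (intro ucont_scaleR_const uniformly_continuous_on_cmul_right
        uniformly_continuous_on_cmul_left ucont_apply_ucbfun)
  note s1 = ucont_shift[OF assms uniformly_continuous_on_add[OF uniformly_continuous_on_id 1]]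
  note s2 = ucont_shift[OF assms uniformly_continuous_on_diff[OF uniformly_continuous_on_id 1]]
  note s3 = ucont_shift[OF assms uniformly_continuous_on_add[OF uniformly_continuous_on_id
        uniformly_continuous_on_cmul[OF ucont_vec]]]
  have const: "bounded (range (\<lambda>x::real^'n. r))" for r :: real
    by (simp add: image_def)
  show ?thesis
    unfolding shift_expr_def
    using s1 s2 s3 assms
    by (intro conjI bounded_plus_comp bounded_range_sum bounded_range_mult const
        uniformly_continuous_on_add uniformly_continuous_on_sum ucont_mult
        uniformly_continuous_on_const) auto
qed

lift_definition shift_op ::
    "('n::finite \<Rightarrow> (real^'n) ucbfun) \<Rightarrow> ('n \<Rightarrow> (real^'n) ucbfun) \<Rightarrow> (real^'n) ucbfun \<Rightarrow>
     real \<Rightarrow> (real^'n) ucbfun \<Rightarrow> (real^'n) ucbfun"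
  is "shift_expr :: ('n::finite \<Rightarrow> (real^'n) ucbfun) \<Rightarrow> ('n \<Rightarrow> (real^'n) ucbfun) \<Rightarrow>
     (real^'n) ucbfun \<Rightarrow> real \<Rightarrow> (real^'n \<Rightarrow> real) \<Rightarrow> real^'n \<Rightarrow> real"
  by (simp add: shift_expr_ucb)

end

theory Submission
  imports Defs
begin

text \<open>This is Chernoff's product formula for \<open>S\<close>, with \<open>C\<^sub>b\<^sup>\<infinity>\<close> as a core. Taylor's formula and the
  uniform continuity of the derivatives give \<open>(S(h)\<phi> - \<phi>)/h \<rightarrow> H\<phi>\<close> uniformly for \<open>\<phi>\<close> in the core,
  and \<open>\<parallel>S(h)\<parallel> \<le> 1 + h\<parallel>c\<parallel>\<close>. For \<open>f\<close> in the domain of the closure this consistency need not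
  hold along the orbit \<open>T(s)f\<close>, which may leave the core. One therefore chooses core elements
  \<open>\<phi>\<^sub>i\<close> close to \<open>T(i d)f\<close> in the graph norm, with an error small compared to \<open>d\<close>, and
  interpolates them linearly. The resulting curve \<open>v\<close> stays near the orbit, takes
  values in a finite-dimensional part of the core and has \<open>v' \<approx> Hv\<close>, so
  \<open>S(h)v(s) - v(s + h)\<close> is at most \<open>\<epsilon>h\<close> uniformly in \<open>s\<close>, and stability sums these errors up.
  No resolvents are needed; the local boundedness of \<open>T\<close> is inherited from that of the products.\<close>

subsection \<open>Operator semigroups and their generators\<close>

text \<open>The definition of a generator gives right derivatives only, so the usual mean value
  theorem does not apply to orbits. For each slope \<open>e > 0\<close> the points up to which
  \<open>w\<close> has grown at most at rate \<open>e\<close> form a compact set; at its largest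
  point the vanishing right derivative would allow a further step to the right, unless that point is
  \<open>b\<close>.\<close>

lemma zero_right_derivative_imp_eq:
  fixes w :: "real \<Rightarrow> 'a::real_normed_vector"
  assumes "a \<le> b" and cont: "continuous_on {a..b} w"
    and der: "\<And>s. a \<le> s \<Longrightarrow> s < b \<Longrightarrow> ((\<lambda>h. (w (s + h) - w s) /\<^sub>R h) \<longlongrightarrow> 0) (at_right 0)"
  shows "w b = w a"
proof -
  have bound: "norm (w b - w a) \<le> e * (b - a)" if "e > 0" for e
  proof (rule ccontr)
    assume bad: "\<not> norm (w b - w a) \<le> e * (b - a)"
    define G where "G = {s \<in> {a..b}. norm (w s - w a) \<le> e * (s - a)}"
    have "closed G" unfolding G_def
      by (intro continuous_on_closed_Collect_le continuous_intros cont closed_real_atLeastAtMost)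
    moreover have "G \<subseteq> {a..b}" by (auto simp: G_def)
    ultimately have "compact G"
      by (metis Int_absorb1 compact_Icc compact_Int_closed)
    moreover have "a \<in> G" using \<open>a \<le> b\<close> by (simp add: G_def)
    ultimately obtain s where s: "s \<in> G" "\<And>r. r \<in> G \<Longrightarrow> r \<le> s"
      using compact_attains_sup[of G] by blast
    \<comment> \<open>If the maximum were \<open>b\<close> itself, membership in \<open>G\<close>
      would be the bound that is assumed to fail.\<close>
    have "s < b" using s(1) bad by (cases "s = b") (auto simp: G_def)
    then have "((\<lambda>h. (w (s + h) - w s) /\<^sub>R h) \<longlongrightarrow> 0) (at_right 0)"
      using s(1) by (intro der) (auto simp: G_def)
    then have "\<forall>\<^sub>F h in at_right 0. norm ((w (s + h) - w s) /\<^sub>R h) < e"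
      using \<open>e > 0\<close> by (auto simp: tendsto_iff)
    moreover have "\<forall>\<^sub>F h in at_right 0. h \<in> {0<..<b - s}"
      using \<open>s < b\<close> by (auto simp: eventually_at_right_field intro!: exI[of _ "b - s"])
    ultimately have "\<forall>\<^sub>F h in at_right 0. norm ((w (s + h) - w s) /\<^sub>R h) < e \<and> h \<in> {0<..<b - s}"
      by (rule eventually_conj)
    then obtain h where h: "norm ((w (s + h) - w s) /\<^sub>R h) < e" "0 < h" "h < b - s"
      using eventually_happens'[OF trivial_limit_at_right_real] by force
    have "norm (w (s + h) - w s) \<le> e * h"
      using h by (simp add: divide_simps mult.commute less_imp_le)
    moreover have "norm (w s - w a) \<le> e * (s - a)" using s(1) by (simp add: G_def)
    moreover have "norm (w (s + h) - w a) \<le> norm (w (s + h) - w s) + norm (w s - w a)"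
      using norm_triangle_ineq[of "w (s + h) - w s" "w s - w a"] by simp
    ultimately have "s + h \<in> G" using s(1) h by (auto simp: G_def algebra_simps)
    then show False using s(2) h(2) by fastforce
  qed
  show ?thesis
  proof (cases "a = b")
    case False
    then have "norm (w b - w a) \<le> 0 + e" if "e > 0" for e
      using bound[of "e / (b - a)"] that \<open>a \<le> b\<close> by simp
    then have "norm (w b - w a) \<le> 0" by (rule field_le_epsilon)
    then show ?thesis by simp
  qed simp
qed

section \<open>Orbits, their integrals and the domain of the generator\<close>

lemma C0_semigroupD:
  assumes "C0_semigroup T"
  shows "T 0 x = x"
    and "0 \<le> s \<Longrightarrow> 0 \<le> t \<Longrightarrow> T (s + t) x = T s (T t x)"
    and "continuous_on {0..} (\<lambda>t. T t x)"
  using assms unfolding C0_semigroup_def by auto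

text \<open>\<open>T t\<close> commutes with every \<open>T h\<close>, so it carries the difference
  quotients of \<open>x\<close> to those of \<open>T t x\<close>, and it is continuous.\<close>

lemma generator_invariant:
  assumes T: "C0_semigroup T" and xy: "(x, y) \<in> generator T" and "0 \<le> t"
  shows "(T t x, T t y) \<in> generator T"
proof -
  have "((\<lambda>h. T t ((T h x - x) /\<^sub>R h)) \<longlongrightarrow> T t y) (at_right 0)"
    using xy unfolding generator_def by (auto intro!: tendsto_intros)
  moreover have "\<forall>\<^sub>F h in at_right 0. T t ((T h x - x) /\<^sub>R h) = (T h (T t x) - T t x) /\<^sub>R h"
    using eventually_at_right_less[of "0::real"]
  proof eventually_elim
    case (elim h)
    then have "T t (T h x) = T h (T t x)"
      using C0_semigroupD(2)[OF T, of t h x] C0_semigroupD(2)[OF T, of h t x] \<open>0 \<le> t\<close>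
      by (simp add: add.commute)
    then show ?case by (simp add: blinfun.scaleR_right blinfun.diff_right)
  qed
  ultimately show ?thesis
    unfolding generator_def using Lim_transform_eventually by fastforce
qed

text \<open>This is the fundamental theorem of calculus at the left endpoint. The length 1 of the
  auxiliary interval is arbitrary, since within \<open>{a..a + 1}\<close> the filter at
  \<open>a\<close> is \<open>at_right a\<close>.\<close>

lemma average_tendsto:
  fixes f :: "real \<Rightarrow> 'a::banach"
  assumes "continuous_on {a..} f"
  shows "((\<lambda>h. integral {a..a + h} f /\<^sub>R h) \<longlongrightarrow> f a) (at_right 0)"
proof -
  have "((\<lambda>u. integral {a..u} f) has_vector_derivative f a) (at a within {a..a + 1})"
    by (rule integral_has_vector_derivative) (auto intro: continuous_on_subset[OF assms])
  then have lim: "((\<lambda>u. (integral {a..u} f - (u - a) *\<^sub>R f a) /\<^sub>R (u - a)) \<longlongrightarrow> 0) (at_right a)"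
    unfolding has_vector_derivative_def has_derivative_iff_norm at_within_Icc_at_right[of a "a + 1"]
    by (subst tendsto_norm_zero_iff[symmetric]) (simp add: divide_inverse mult.commute at_within_Icc_at_right)
  then have "((\<lambda>h. (integral {a..a + h} f - h *\<^sub>R f a) /\<^sub>R h + f a) \<longlongrightarrow> 0 + f a) (at_right 0)"
    unfolding filterlim_at_right_to_0[of _ _ a] by (intro tendsto_intros) (simp add: add.commute)
  moreover have "\<forall>\<^sub>F h in at_right 0. (integral {a..a + h} f - h *\<^sub>R f a) /\<^sub>R h + f a = integral {a..a + h} f /\<^sub>R h"
    using eventually_at_right_less[of "0::real"] by eventually_elim (simp add: scaleR_diff_right)
  ultimately show ?thesis
    using Lim_transform_eventually by fastforce
qed

text \<open>Applying \<open>T h\<close> shifts the interval of integration by \<open>h\<close>. The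
  overlap cancels in the difference, and two short averages remain, at \<open>t\<close> and at 0,
  which converge to the values of the orbit there. The same fact yields density of the domain and
  the mild solution.\<close>

lemma generator_integral:
  fixes T :: "real \<Rightarrow> 'a::banach \<Rightarrow>\<^sub>L 'a"
  assumes T: "C0_semigroup T" and "0 \<le> t"
  shows "(integral {0..t} (\<lambda>s. T s x), T t x - x) \<in> generator T"
proof -
  let ?f = "\<lambda>s. T s x"
  note cont = C0_semigroupD(3)[OF T, of x]
  have int: "?f integrable_on {p..q}" if "0 \<le> p" for p q
    by (rule integrable_continuous_real) (use that in \<open>auto intro: continuous_on_subset[OF cont]\<close>)
  have "(T h (integral {0..t} ?f) - integral {0..t} ?f) /\<^sub>R h =
      integral {t..t + h} ?f /\<^sub>R h - integral {0..0 + h} ?f /\<^sub>R h" if "h > 0" for h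
  proof -
    have "T h (integral {0..t} ?f) = integral {0..t} (\<lambda>s. T h (T s x))"
      using integral_linear[OF int[of 0 t] blinfun.bounded_linear_right[of "T h"]] by (simp add: o_def)
    also have "\<dots> = integral {0..t} (\<lambda>s. T (s + h) x)"
      using C0_semigroupD(2)[OF T, of h] that by (intro integral_cong) (simp add: add.commute)
    also have "\<dots> = integral {h..t + h} ?f"
      using integral_shift_real_ivl[of h h "t + h" ?f] by (simp add: add.commute)
    finally have "T h (integral {0..t} ?f) = integral {h..t + h} ?f" .
    moreover have "integral {0..h} ?f + integral {h..t + h} ?f = integral {0..t + h} ?f"
      "integral {0..t} ?f + integral {t..t + h} ?f = integral {0..t + h} ?f"
      using that \<open>0 \<le> t\<close> int by (auto intro!: Henstock_Kurzweil_Integration.integral_combine)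
    ultimately have "T h (integral {0..t} ?f) - integral {0..t} ?f = integral {t..t + h} ?f - integral {0..h} ?f"
      by (simp add: algebra_simps)
    then show ?thesis by (simp add: scaleR_diff_right)
  qed
  then have "\<forall>\<^sub>F h in at_right 0. integral {t..t + h} ?f /\<^sub>R h - integral {0..0 + h} ?f /\<^sub>R h =
    (T h (integral {0..t} ?f) - integral {0..t} ?f) /\<^sub>R h"
    using eventually_at_right_less[of "0::real"] by (auto elim: eventually_mono)
  moreover have "((\<lambda>h. integral {t..t + h} ?f /\<^sub>R h - integral {0..0 + h} ?f /\<^sub>R h) \<longlongrightarrow> T t x - T 0 x)
    (at_right 0)"
    using \<open>0 \<le> t\<close> by (intro tendsto_diff average_tendsto continuous_on_subset[OF cont]) auto
  ultimately show ?thesis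
    unfolding generator_def C0_semigroupD(1)[OF T] using Lim_transform_eventually by fastforce
qed

text \<open>The approximants are the averages of the orbit of \<open>x\<close> over
  \<open>{0..h}\<close>: they lie in the domain by \<open>generator_integral\<close> and tend to
  \<open>x\<close> as \<open>h\<close> decreases to 0.\<close>

lemma generator_dense:
  fixes T :: "real \<Rightarrow> 'a::banach \<Rightarrow>\<^sub>L 'a"
  assumes T: "C0_semigroup T" and "0 < e"
  obtains y z where "(y, z) \<in> generator T" "norm (x - y) < e"
proof -
  have "((\<lambda>h. integral {0..0 + h} (\<lambda>s. T s x) /\<^sub>R h) \<longlongrightarrow> T 0 x) (at_right 0)"
    using C0_semigroupD(3)[OF T] by (rule average_tendsto)
  then have "\<forall>\<^sub>F h in at_right 0. dist (integral {0..0 + h} (\<lambda>s. T s x) /\<^sub>R h) (T 0 x) < e"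
    using \<open>0 < e\<close> by (rule tendstoD)
  then have "\<forall>\<^sub>F h in at_right 0. h > 0 \<and> norm (x - integral {0..0 + h} (\<lambda>s. T s x) /\<^sub>R h) < e"
    using eventually_at_right_less[of "0::real"]
    by eventually_elim (simp add: dist_norm norm_minus_commute C0_semigroupD(1)[OF T])
  then obtain h :: real where h: "h > 0" "norm (x - integral {0..h} (\<lambda>s. T s x) /\<^sub>R h) < e"
    using eventually_happens[of _ "at_right (0::real)"] by auto
  have "(integral {0..h} (\<lambda>s. T s x), T h x - x) \<in> generator T"
    using generator_integral[OF T, of h x] h by simp
  then have "((\<lambda>k. ((T k (integral {0..h} (\<lambda>s. T s x)) - integral {0..h} (\<lambda>s. T s x)) /\<^sub>R k) /\<^sub>R h)
      \<longlongrightarrow> (T h x - x) /\<^sub>R h) (at_right 0)"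
    by (intro tendsto_scaleR[OF tendsto_const]) (simp add: generator_def)
  then have "(integral {0..h} (\<lambda>s. T s x) /\<^sub>R h, (T h x - x) /\<^sub>R h) \<in> generator T"
    unfolding generator_def
    by (simp add: blinfun.scaleR_right scaleR_diff_right mult.commute)
  then show ?thesis using that h by blast
qed

text \<open>This upgrades the right derivative of the orbit to a two-sided one. The orbit minus the
  integral of \<open>T s y\<close> has zero right derivative, hence is constant, and the integral of
  a continuous function is differentiable from both sides.\<close>

lemma generator_has_vector_derivative:
  fixes T :: "real \<Rightarrow> 'a::banach \<Rightarrow>\<^sub>L 'a"
  assumes T: "C0_semigroup T" and xy: "(x, y) \<in> generator T" and "0 \<le> t"
  shows "((\<lambda>t. T t x) has_vector_derivative T t y) (at t within {0..})"
proof -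
  let ?I = "\<lambda>t. integral {0..t} (\<lambda>s. T s y)"
  have I: "(?I has_vector_derivative T s y) (at s within {0..r})" if "0 \<le> s" "s \<le> r" for s r
    using that C0_semigroupD(3)[OF T, of y]
    by (intro integral_has_vector_derivative) (auto intro: continuous_on_subset)
  have eq: "T s x - ?I s = x" if "0 \<le> s" for s
  proof -
    have "T s x - ?I s = T 0 x - ?I 0"
    proof (rule zero_right_derivative_imp_eq[OF that])
      show "continuous_on {0..s} (\<lambda>s. T s x - ?I s)"
        by (intro continuous_on_diff indefinite_integral_continuous_1 integrable_continuous_real
            continuous_on_subset[OF C0_semigroupD(3)[OF T]]) auto
      fix r assume r: "0 \<le> r" "r < s"
      have 1: "((\<lambda>h. (T h (T r x) - T r x) /\<^sub>R h) \<longlongrightarrow> T r y) (at_right 0)"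
        using generator_invariant[OF T xy r(1)] by (simp add: generator_def)
      have 2: "((\<lambda>h. integral {r..r + h} (\<lambda>s. T s y) /\<^sub>R h) \<longlongrightarrow> T r y) (at_right 0)"
        using r by (intro average_tendsto continuous_on_subset[OF C0_semigroupD(3)[OF T]]) auto
      have "\<forall>\<^sub>F h in at_right 0. (T h (T r x) - T r x) /\<^sub>R h - integral {r..r + h} (\<lambda>s. T s y) /\<^sub>R h =
        (T (r + h) x - ?I (r + h) - (T r x - ?I r)) /\<^sub>R h"
        using eventually_at_right_less[of "0::real"]
      proof eventually_elim
        case (elim h)
        then have "?I r + integral {r..r + h} (\<lambda>s. T s y) = ?I (r + h)"
          using r
          by (intro Henstock_Kurzweil_Integration.integral_combine integrable_continuous_real
              continuous_on_subset[OF C0_semigroupD(3)[OF T]]) auto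
        moreover have "T (r + h) x = T h (T r x)"
          using C0_semigroupD(2)[OF T, of h r] elim r by (simp add: add.commute)
        ultimately show ?case by (simp add: algebra_simps flip: scaleR_diff_right)
      qed
      then show "((\<lambda>h. (T (r + h) x - ?I (r + h) - (T r x - ?I r)) /\<^sub>R h) \<longlongrightarrow> 0) (at_right 0)"
        using tendsto_diff[OF 1 2] Lim_transform_eventually by fastforce
    qed
    then show ?thesis using C0_semigroupD(1)[OF T] by simp
  qed
  have "((\<lambda>s. x + ?I s) has_vector_derivative T t y) (at t within {0..t + 1})"
    using I[of t "t + 1"] \<open>0 \<le> t\<close> by (auto intro!: derivative_eq_intros)
  then have "((\<lambda>s. T s x) has_vector_derivative T t y) (at t within {0..t + 1})"
    by (rule has_vector_derivative_transform[rotated 2])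
      (use \<open>0 \<le> t\<close> eq in \<open>auto simp: algebra_simps\<close>)
  \<comment> \<open>The bounded interval was needed for integration only; near \<open>t\<close> it
    coincides with the half-line.\<close>
  moreover have "at t within {0..t + 1} = at t within {0..}"
    by (rule at_within_nhd[of t "{..<t + 1}"]) auto
  ultimately show ?thesis by simp
qed

subsection \<open>Chernoff's product formula\<close>

text \<open>The limit in \<open>cons\<close> has a rate that depends on the core element. A curve
  built from finitely many core elements makes one threshold \<open>h0\<close> serve all times in
  \<open>{0..t0}\<close>. The constant 7 is 3 + 4: the errors of \<open>S h (v s)\<close> and of
  \<open>v (s + h)\<close> against the common comparison
  \<open>v s + h *\<^sub>R g s\<close>.\<close>

lemma chernoff_core_step:
  fixes u g :: "real \<Rightarrow> 'a::real_normed_vector" and S :: "real \<Rightarrow> 'a \<Rightarrow> 'a"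
  assumes A: "\<And>s. 0 \<le> s \<Longrightarrow> (u s, g s) \<in> closure A"
    and deriv: "\<And>s. 0 \<le> s \<Longrightarrow> (u has_vector_derivative g s) (at s within {0..})"
    and g: "continuous_on {0..} g"
    and lin: "\<And>h. 0 \<le> h \<Longrightarrow> linear (S h)"
    and cons: "\<And>x y. (x, y) \<in> A \<Longrightarrow> ((\<lambda>h. (S h x - x) /\<^sub>R h) \<longlongrightarrow> y) (at_right 0)"
    and "0 < e" "0 \<le> t0"
  obtains v h0 where "0 < h0"
    and "\<And>s. 0 \<le> s \<Longrightarrow> s \<le> t0 \<Longrightarrow> norm (v s - u s) \<le> 2 * e"
    and "\<And>s h. 0 \<le> s \<Longrightarrow> 0 < h \<Longrightarrow> h < h0 \<Longrightarrow> s + h \<le> t0 \<Longrightarrow> norm (S h (v s) - v (s + h)) \<le> 7 * e * h"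
proof -
  have u: "continuous_on {0..} u"
    using deriv by (auto intro: has_vector_derivative_continuous simp: continuous_on_eq_continuous_within)
  have uc: "uniformly_continuous_on {0..t0 + 2} u" "uniformly_continuous_on {0..t0 + 2} g"
    using u g by (auto intro!: compact_uniformly_continuous intro: continuous_on_subset)
  obtain du where "du > 0" and du:
    "\<And>r s. r \<in> {0..t0 + 2} \<Longrightarrow> s \<in> {0..t0 + 2} \<Longrightarrow> dist s r < du \<Longrightarrow> dist (u s) (u r) < e"
    using uniformly_continuous_onE[OF uc(1) \<open>e > 0\<close>] by metis
  obtain dg where "dg > 0" and dg:
    "\<And>r s. r \<in> {0..t0 + 2} \<Longrightarrow> s \<in> {0..t0 + 2} \<Longrightarrow> dist s r < dg \<Longrightarrow> dist (g s) (g r) < e"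
    using uniformly_continuous_onE[OF uc(2) \<open>e > 0\<close>] by metis
  \<comment> \<open>The mesh width. Halving makes the bounds strict, and \<open>d < 1\<close> keeps
    all nodes used below inside \<open>{0..t0 + 2}\<close>, where the moduli of continuity
    hold.\<close>
  define d where "d = min 1 (min du dg) / 2"
  have d: "0 < d" "d < du" "d < dg" "d < 1"
    using \<open>du > 0\<close> \<open>dg > 0\<close> by (auto simp: d_def min_def)
  have ud: "norm (u r - u s) \<le> e" and gd: "norm (g r - g s) \<le> e"
    if "0 \<le> r" "0 \<le> s" "r \<le> t0 + 2" "s \<le> t0 + 2" "\<bar>r - s\<bar> \<le> d" for r s
    using du[of s r] dg[of s r] that d by (auto simp: dist_norm)
  \<comment> \<open>The first components are matched to within \<open>e * d\<close>, not just
    \<open>e\<close>, because the slopes of the interpolant divide their differences by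
    \<open>d\<close>.\<close>
  have "\<exists>x y. (x, y) \<in> A \<and> norm (x - u (real i * d)) \<le> e * d \<and> norm (y - g (real i * d)) \<le> e" for i
  proof -
    have "(u (real i * d), g (real i * d)) \<in> closure A" using d by (intro A) simp
    moreover have "0 < min (e * d) e" using \<open>e > 0\<close> d by simp
    ultimately obtain p where "p \<in> A" "dist p (u (real i * d), g (real i * d)) < min (e * d) e"
      unfolding closure_approachable by blast
    then show ?thesis
      using dist_fst_le[of p "(u (real i * d), g (real i * d))"]
        dist_snd_le[of p "(u (real i * d), g (real i * d))"]
      by (intro exI[of _ "fst p"] exI[of _ "snd p"]) (auto simp: dist_norm)
  qed
  then obtain \<phi> \<psi> where \<phi>: "\<And>i. (\<phi> i, \<psi> i) \<in> A" "\<And>i. norm (\<phi> i - u (real i * d)) \<le> e * d"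
      "\<And>i. norm (\<psi> i - g (real i * d)) \<le> e"
    by metis
  \<comment> \<open>Intervals 0 to \<open>m\<close> cover \<open>{0..t0}\<close>. If
    \<open>t0 / d\<close> is an integer, \<open>t0\<close> falls into interval \<open>m\<close>, so
    node \<open>Suc m\<close> is used as well.\<close>
  define m where "m = nat \<lceil>t0 / d\<rceil>"
  have m: "real i * d \<le> t0 + 1" if "i \<le> m" for i
  proof -
    have "real m \<le> t0 / d + 1" using \<open>0 \<le> t0\<close> d by (simp add: m_def of_nat_ceiling) 
    then have "real i * d \<le> (t0 / d + 1) * d" using that d by (intro mult_right_mono) auto
    then show ?thesis using d by (simp add: algebra_simps)
  qed
  define D where "D i = (\<phi> (Suc i) - \<phi> i) /\<^sub>R d" for i
  \<comment> \<open>Of the three errors \<open>e\<close>, one is the oscillation of \<open>g\<close>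
    over a mesh interval, by the mean value inequality for \<open>u\<close>; the other two come from
    the endpoints, each displaced by at most \<open>e * d\<close>.\<close>
  have D: "norm (D i - g (real i * d)) \<le> 3 * e" if "i \<le> m" for i
  proof -
    let ?r = "real i * d" and ?s = "real (Suc i) * d"
    have s: "?s = ?r + d" "0 \<le> ?r" using d by (simp_all add: algebra_simps)
    have in_range: "0 \<le> x" "x \<le> t0 + 2" "\<bar>x - ?r\<bar> \<le> d" if "x \<in> {?r..?s}" for x
      using that s m[OF \<open>i \<le> m\<close>] d unfolding atLeastAtMost_iff by linarith+
    have "norm (u ?s - u ?r - (?s - ?r) *\<^sub>R g ?r) \<le> norm (?s - ?r) * e"
    proof (rule vector_differentiable_bound_linearization[where S = "{?r..?s}"])
      show "(u has_vector_derivative g x) (at x within {?r..?s})" if "x \<in> {?r..?s}" for x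
        by (rule has_vector_derivative_within_subset[OF deriv[OF in_range(1)[OF that]]])
          (intro subsetI atLeast_iff[THEN iffD2] in_range(1))
      show "norm (g x - g ?r) \<le> e" if "x \<in> {?r..?s}" for x
        by (rule gd) (use in_range[OF that] m[OF \<open>i \<le> m\<close>] s(2) d in linarith)+
    qed (use s d in \<open>auto simp: closed_segment_eq_real_ivl\<close>)
    then have 1: "norm (u ?s - u ?r - d *\<^sub>R g ?r) \<le> d * e" using s d by simp
    have "norm (\<phi> (Suc i) - \<phi> i - d *\<^sub>R g ?r) \<le> 3 * (d * e)"
      using 1 \<phi>(2)[of "Suc i"] \<phi>(2)[of i]
        norm_triangle_ineq[of "\<phi> (Suc i) - u ?s + (u ?s - u ?r - d *\<^sub>R g ?r)" "u ?r - \<phi> i"]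
        norm_triangle_ineq[of "\<phi> (Suc i) - u ?s" "u ?s - u ?r - d *\<^sub>R g ?r"] norm_minus_commute[of "u ?r" "\<phi> i"]
      by (simp add: algebra_simps)
    moreover have "D i - g ?r = (\<phi> (Suc i) - \<phi> i - d *\<^sub>R g ?r) /\<^sub>R d"
      using d by (simp add: D_def scaleR_diff_right)
    then have "norm (D i - g ?r) = norm (\<phi> (Suc i) - \<phi> i - d *\<^sub>R g ?r) / d"
      using d by (simp add: divide_inverse mult.commute)
    ultimately show ?thesis using d by (simp add: divide_le_eq mult_ac)
  qed
  define v where "v s = (let i = nat \<lfloor>s / d\<rfloor> in \<phi> i + (s - real i * d) *\<^sub>R D i)" for s
  \<comment> \<open>The formula of interval \<open>i\<close> also holds at its right endpoint, where
    the floor in \<open>v\<close> already selects the next interval: the two pieces agree at the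
    node.\<close>
  have v_eq: "v s = \<phi> i + (s - real i * d) *\<^sub>R D i" if "real i * d \<le> s" "s \<le> real (Suc i) * d" for s i
  proof (cases "s = real (Suc i) * d")
    case True
    then have "nat \<lfloor>s / d\<rfloor> = Suc i" using d by simp
    moreover have "s - real i * d = d" using True by (simp add: algebra_simps)
    ultimately show ?thesis using d True by (simp add: v_def D_def)
  next
    case False
    then have "real i \<le> s / d" "s / d < real i + 1" using that d by (auto simp: field_simps)
    then have "nat \<lfloor>s / d\<rfloor> = i" by linarith
    then show ?thesis by (simp add: v_def)
  qed
  have v_diff: "v r - v s = (r - s) *\<^sub>R D i"
    if "real i * d \<le> s" "s \<le> real (Suc i) * d" "real i * d \<le> r" "r \<le> real (Suc i) * d" for r s i
    unfolding v_eq[OF that(1,2)] v_eq[OF that(3,4)] by (simp add: algebra_simps)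
  have index: "\<exists>i\<le>m. real i * d \<le> s \<and> s \<le> real (Suc i) * d" if "0 \<le> s" "s \<le> t0" for s
  proof (intro exI[of _ "nat \<lfloor>s / d\<rfloor>"] conjI)
    have 0: "0 \<le> s / d" using that d by simp
    have 1: "real (nat \<lfloor>s / d\<rfloor>) \<le> s / d" "s / d < real (nat \<lfloor>s / d\<rfloor>) + 1"
      using 0 by linarith+
    have "s / d \<le> t0 / d" using that d by (simp add: divide_right_mono)
    then show "nat \<lfloor>s / d\<rfloor> \<le> m" unfolding m_def by linarith
    show "real (nat \<lfloor>s / d\<rfloor>) * d \<le> s" "s \<le> real (Suc (nat \<lfloor>s / d\<rfloor>)) * d"
      using 1 d by (auto simp: field_simps)
  qed
  have convex: "\<exists>\<theta>. 0 \<le> \<theta> \<and> \<theta> \<le> 1 \<and> v s = (1 - \<theta>) *\<^sub>R \<phi> i + \<theta> *\<^sub>R \<phi> (Suc i)"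
    if "real i * d \<le> s" "s \<le> real (Suc i) * d" for s i
  proof (intro exI[of _ "(s - real i * d) / d"] conjI)
    show "v s = (1 - (s - real i * d) / d) *\<^sub>R \<phi> i + ((s - real i * d) / d) *\<^sub>R \<phi> (Suc i)"
      unfolding v_eq[OF that] D_def by (simp add: algebra_simps divide_inverse)
  qed (use that d in \<open>auto simp: field_simps\<close>)
  \<comment> \<open>Consistency is invoked at the finitely many nodes only, hence a single threshold
    \<open>h1\<close>; between nodes, linearity of \<open>S h\<close> takes over.\<close>
  have "\<forall>\<^sub>F h in at_right 0. \<forall>i\<in>{..Suc m}. dist ((S h (\<phi> i) - \<phi> i) /\<^sub>R h) (\<psi> i) < e"
    using cons[OF \<phi>(1)] \<open>0 < e\<close> by (intro eventually_ball_finite) (auto intro: tendstoD)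
  then obtain h1 where "h1 > 0"
    and h1: "\<And>h i. 0 < h \<Longrightarrow> h < h1 \<Longrightarrow> i \<le> Suc m \<Longrightarrow> dist ((S h (\<phi> i) - \<phi> i) /\<^sub>R h) (\<psi> i) < e"
    unfolding eventually_at_right_field by auto
  have step: "norm (S h (\<phi> i) - \<phi> i - h *\<^sub>R \<psi> i) \<le> h * e" if "0 < h" "h < h1" "i \<le> Suc m" for h i
  proof -
    have "S h (\<phi> i) - \<phi> i - h *\<^sub>R \<psi> i = h *\<^sub>R ((S h (\<phi> i) - \<phi> i) /\<^sub>R h - \<psi> i)"
      using that(1) by (simp add: scaleR_diff_right)
    then have "norm (S h (\<phi> i) - \<phi> i - h *\<^sub>R \<psi> i) = h * dist ((S h (\<phi> i) - \<phi> i) /\<^sub>R h) (\<psi> i)"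
      using that(1) by (simp only: norm_scaleR dist_norm abs_of_pos)
    then show ?thesis using h1[OF that] that(1) by (simp add: less_imp_le)
  qed
  show ?thesis
  proof (rule that[of "min d h1" v])
    show "0 < min d h1" using d \<open>h1 > 0\<close> by simp
  next
    fix s assume s: "0 \<le> s" "s \<le> t0"
    then obtain i where i: "i \<le> m" "real i * d \<le> s" "s \<le> real (Suc i) * d" using index by blast
    obtain \<theta> where \<theta>: "0 \<le> \<theta>" "\<theta> \<le> 1" "v s = (1 - \<theta>) *\<^sub>R \<phi> i + \<theta> *\<^sub>R \<phi> (Suc i)"
      using convex[OF i(2,3)] by blast
    have ed: "e * d \<le> e" using d \<open>e > 0\<close> by simp
    have *: "norm (\<phi> j - u s) \<le> 2 * e" if "j = i \<or> j = Suc i" for j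
    proof -
      have "norm (u (real j * d) - u s) \<le> e"
        using that i s m[OF i(1)] d by (intro ud) (auto simp: algebra_simps)
      then show ?thesis
        using \<phi>(2)[of j] ed norm_triangle_ineq[of "\<phi> j - u (real j * d)" "u (real j * d) - u s"] by simp
    qed
    have "v s - u s = (1 - \<theta>) *\<^sub>R (\<phi> i - u s) + \<theta> *\<^sub>R (\<phi> (Suc i) - u s)"
      unfolding \<theta>(3) by (simp add: algebra_simps)
    also have "norm \<dots> \<le> (1 - \<theta>) * (2 * e) + \<theta> * (2 * e)"
      using \<theta> by (intro norm_triangle_le add_mono) (auto intro!: mult_left_mono *)
    finally show "norm (v s - u s) \<le> 2 * e" by (simp add: algebra_simps)
  next
    fix s h assume s: "0 \<le> s" "0 < h" "h < min d h1" "s + h \<le> t0"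
    then obtain i where i: "i \<le> m" "real i * d \<le> s" "s \<le> real (Suc i) * d" using index[of s] by auto
    obtain \<theta> where \<theta>: "0 \<le> \<theta>" "\<theta> \<le> 1" "v s = (1 - \<theta>) *\<^sub>R \<phi> i + \<theta> *\<^sub>R \<phi> (Suc i)"
      using convex[OF i(2,3)] by blast
    \<comment> \<open>One \<open>e\<close> is the consistency error at the node, one the distance of
      \<open>\<psi> j\<close> from \<open>g\<close> there, one the oscillation of \<open>g\<close>
      between the node and \<open>s\<close>.\<close>
    have *: "norm (S h (\<phi> j) - \<phi> j - h *\<^sub>R g s) \<le> h * (3 * e)" if "j = i \<or> j = Suc i" for j
    proof -
      have "norm (g (real j * d) - g s) \<le> e"
        using that i s m[OF i(1)] d by (intro gd) (auto simp: algebra_simps)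
      then have "norm (\<psi> j - g s) \<le> 2 * e"
        using \<phi>(3)[of j] norm_triangle_ineq[of "\<psi> j - g (real j * d)" "g (real j * d) - g s"] by simp
      then have "norm (h *\<^sub>R (\<psi> j - g s)) \<le> h * (2 * e)"
        using s(2) by simp
      moreover have "norm (S h (\<phi> j) - \<phi> j - h *\<^sub>R \<psi> j) \<le> h * e"
        using s that i(1) by (intro step) auto
      ultimately show ?thesis
        using norm_triangle_ineq[of "S h (\<phi> j) - \<phi> j - h *\<^sub>R \<psi> j" "h *\<^sub>R (\<psi> j - g s)"]
        by (simp add: algebra_simps)
    qed
    have "S h (v s) - v s - h *\<^sub>R g s =
      (1 - \<theta>) *\<^sub>R (S h (\<phi> i) - \<phi> i - h *\<^sub>R g s) + \<theta> *\<^sub>R (S h (\<phi> (Suc i)) - \<phi> (Suc i) - h *\<^sub>R g s)"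
    proof -
      have "S h (v s) = (1 - \<theta>) *\<^sub>R S h (\<phi> i) + \<theta> *\<^sub>R S h (\<phi> (Suc i))"
        using lin[of h] s(2) unfolding \<theta>(3) by (simp only: linear_add linear_scale less_imp_le)
      then show ?thesis unfolding \<theta>(3) by (simp add: algebra_simps)
    qed
    also have "norm \<dots> \<le> (1 - \<theta>) * (h * (3 * e)) + \<theta> * (h * (3 * e))"
      using \<theta> by (intro norm_triangle_le add_mono) (auto intro!: mult_left_mono *)
    finally have 1: "norm (S h (v s) - v s - h *\<^sub>R g s) \<le> h * (3 * e)" by (simp add: algebra_simps)
    have D': "norm (D j - g s) \<le> 4 * e" if "j = i \<or> j = Suc i" "j \<le> m" for j
    proof -
      have "norm (g (real j * d) - g s) \<le> e"
        using that i s m[OF i(1)] d by (intro gd) (auto simp: algebra_simps)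
      then show ?thesis
        using D[OF that(2)] norm_triangle_ineq[of "D j - g (real j * d)" "g (real j * d) - g s"] by simp
    qed
    have scaled: "norm (r *\<^sub>R (D j - g s)) \<le> r * (4 * e)" if "0 \<le> r" "j = i \<or> j = Suc i" "j \<le> m" for r j
      using D'[OF that(2,3)] that(1) by (simp add: mult_left_mono)
    \<comment> \<open>Since \<open>h < d\<close>, the step crosses at most one node. If it does, it
      is split there, and each part moves with a slope within \<open>4 * e\<close> of
      \<open>g s\<close>.\<close>
    have 2: "norm (v (s + h) - v s - h *\<^sub>R g s) \<le> h * (4 * e)"
    proof (cases "s + h \<le> real (Suc i) * d")
      case True
      then have "v (s + h) - v s - h *\<^sub>R g s = h *\<^sub>R (D i - g s)"
        using v_diff[OF i(2,3), of "s + h"] i(2) s(2) by (simp add: scaleR_diff_right)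
      then show ?thesis using scaled[of h i] s i by simp
    next
      case False
      let ?p = "real (Suc i) * d"
      have p: "?p \<le> s + h" "s + h \<le> real (Suc (Suc i)) * d" "s \<le> ?p" using False s i by (auto simp: algebra_simps)
      have "v (s + h) - v ?p = (s + h - ?p) *\<^sub>R D (Suc i)"
        using v_diff[of "Suc i" ?p "s + h"] p order_trans[OF p(1,2)] by simp
      moreover have "v ?p - v s = (?p - s) *\<^sub>R D i"
        using v_diff[OF i(2,3), of ?p] order_trans[OF i(2,3)] by simp
      moreover have "(s + h - ?p) *\<^sub>R g s + (?p - s) *\<^sub>R g s = h *\<^sub>R g s"
        by (simp flip: scaleR_add_left)
      ultimately have "v (s + h) - v s - h *\<^sub>R g s =
          (s + h - ?p) *\<^sub>R (D (Suc i) - g s) + (?p - s) *\<^sub>R (D i - g s)"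
        by (simp add: scaleR_diff_right diff_eq_eq) (simp add: algebra_simps)
      \<comment> \<open>The crossed node lies strictly before \<open>s + h\<close>, hence before
        \<open>t0\<close>, so the slope estimate is still available for the next interval.\<close>
      moreover have "Suc i \<le> m"
      proof -
        have "real i < t0 / d" "real (Suc i) * d < t0" using False s d by (auto simp: field_simps)
        then have "real (Suc i) < t0 / d" using d by (simp add: field_simps)
        then show ?thesis unfolding m_def by linarith
      qed
      ultimately have "norm (v (s + h) - v s - h *\<^sub>R g s) \<le> (s + h - ?p) * (4 * e) + (?p - s) * (4 * e)"
        using scaled[of "s + h - ?p" "Suc i"] scaled[of "?p - s" i] p i by (auto intro!: norm_triangle_le)
      then show ?thesis by (simp add: algebra_simps)
    qed
    show "norm (S h (v s) - v (s + h)) \<le> 7 * e * h"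
      using 1 2 norm_triangle_ineq4[of "S h (v s) - v s - h *\<^sub>R g s" "v (s + h) - v s - h *\<^sub>R g s"]
      by (simp add: algebra_simps)
  qed
qed

section \<open>Iterated steps: stability and accumulation of local errors\<close>

lemma linear_funpow:
  fixes S :: "'a::real_vector \<Rightarrow> 'a"
  assumes "linear S"
  shows "linear (S ^^ n)"
proof (induction n)
  case (Suc n)
  then show ?case using linear_compose[OF Suc assms] by (simp add: o_def)
qed (simp add: linear_id[unfolded id_def])

lemma norm_funpow_le:
  fixes S :: "'a::real_normed_vector \<Rightarrow> 'a"
  assumes "\<And>x. norm (S x) \<le> K * norm x" "0 \<le> K"
  shows "norm ((S ^^ n) x) \<le> K ^ n * norm x"
proof (induction n)
  case (Suc n)
  have "norm (S ((S ^^ n) x)) \<le> K * (K ^ n * norm x)"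
    using assms(1)[of "(S ^^ n) x"] Suc assms(2) by (meson mult_left_mono order_trans)
  then show ?case by simp
qed simp

lemma one_plus_power_le_exp:
  fixes w t :: real
  assumes "0 \<le> w" "0 \<le> t"
  shows "(1 + w * (t / real n)) ^ n \<le> exp (w * t)"
proof (cases "n = 0")
  case False
  have "(1 + w * (t / real n)) ^ n \<le> exp (w * (t / real n)) ^ n"
    using assms by (intro power_mono exp_ge_add_one_self add_nonneg_nonneg) auto
  also have "\<dots> = exp (w * t)"
    using False by (simp flip: exp_of_nat_mult)
  finally show ?thesis .
qed (use assms in simp)

text \<open>Telescoping: the initial error and the local errors are each propagated by at most
  \<open>n\<close> applications of \<open>S\<close>. As \<open>1 \<le> K\<close>, every propagation
  factor may be replaced by the largest one, \<open>K ^ n\<close>.\<close>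

lemma approximation_error:
  fixes S :: "'a::real_normed_vector \<Rightarrow> 'a" and v :: "nat \<Rightarrow> 'a"
  assumes lin: "linear S" and S: "\<And>x. norm (S x) \<le> K * norm x" and K: "1 \<le> K"
    and init: "norm (x - v 0) \<le> e0" and step: "\<And>k. k < n \<Longrightarrow> norm (S (v k) - v (Suc k)) \<le> e1"
  shows "norm ((S ^^ n) x - v n) \<le> K ^ n * (e0 + real n * e1)"
  using step
proof (induction n)
  case (Suc n)
  have e1: "0 \<le> e1" using Suc.prems[of 0] norm_ge_zero order_trans by blast
  have K': "1 \<le> K ^ Suc n" using K by (rule one_le_power)
  have "norm (S ((S ^^ n) x - v n)) \<le> K * (K ^ n * (e0 + real n * e1))"
    using S[of "(S ^^ n) x - v n"] Suc K by (meson less_SucI mult_left_mono order_trans zero_le_one)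
  moreover have "(S ^^ Suc n) x - v (Suc n) = S ((S ^^ n) x - v n) + (S (v n) - v (Suc n))"
    using lin by (simp add: linear_diff)
  moreover have "norm (S (v n) - v (Suc n)) \<le> K ^ Suc n * e1"
    using Suc.prems[of n] mult_right_mono[OF K' e1] by simp
  ultimately have "norm ((S ^^ Suc n) x - v (Suc n)) \<le> K ^ Suc n * (e0 + real n * e1) + K ^ Suc n * e1"
    by (metis (no_types, lifting) add_mono mult.assoc norm_triangle_le power_Suc)
  then show ?case by (simp add: algebra_simps)
qed (use init in simp)

text \<open>Convergence is proved on the domain of the generator by comparison with the curve of
  \<open>chernoff_core_step\<close>, and then extended by density, using one bound
  \<open>exp (w * t0)\<close> for the products and for \<open>T\<close> on
  \<open>{0..t0}\<close>.\<close>

theorem chernoff: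
  fixes T :: "real \<Rightarrow> 'a::banach \<Rightarrow>\<^sub>L 'a" and S :: "real \<Rightarrow> 'a \<Rightarrow> 'a"
  assumes T: "C0_semigroup T" and gen: "generator T \<subseteq> closure A"
    and lin: "\<And>h. 0 \<le> h \<Longrightarrow> linear (S h)"
    and bound: "\<And>h x. 0 \<le> h \<Longrightarrow> norm (S h x) \<le> (1 + w * h) * norm x" and "0 \<le> w"
    and zero: "\<And>x. S 0 x = x"
    and cons: "\<And>x y. (x, y) \<in> A \<Longrightarrow> ((\<lambda>h. (S h x - x) /\<^sub>R h) \<longlongrightarrow> y) (at_right 0)"
    and "0 \<le> t0"
  shows "uniform_limit {0..t0} (\<lambda>n t. (S (t / real n) ^^ n) x) (\<lambda>t. T t x) sequentially"
proof -
  have bound_iter: "norm ((S (t / real n) ^^ n) x) \<le> exp (w * t1) * norm x" if "0 \<le> t" "t \<le> t1" for t t1 n x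
  proof -
    have "norm ((S (t / real n) ^^ n) x) \<le> (1 + w * (t / real n)) ^ n * norm x"
      using that \<open>0 \<le> w\<close> by (intro norm_funpow_le bound) auto
    also have "\<dots> \<le> exp (w * t) * norm x"
      using that \<open>0 \<le> w\<close> by (intro mult_right_mono one_plus_power_le_exp) auto
    also have "\<dots> \<le> exp (w * t1) * norm x"
      using that \<open>0 \<le> w\<close> by (intro mult_right_mono) (auto simp: mult_left_mono)
    finally show ?thesis .
  qed
  have on_domain: "uniform_limit {0..t1} (\<lambda>n t. (S (t / real n) ^^ n) y) (\<lambda>t. T t y) sequentially"
    if yz: "(y, z) \<in> generator T" and "0 \<le> t1" for y z t1
  proof (rule uniform_limitI)
    fix e :: real assume "e > 0"
    \<comment> \<open>The summand 2 in the parentheses is the initial error and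
      \<open>t1 * 7\<close> the sum of the \<open>n\<close> local errors \<open>7 * e' * h\<close>,
      both amplified by the stability factor; the final 2 returns from \<open>v t\<close> to the
      orbit.\<close>
    define C where "C = exp (w * t1) * (2 + t1 * 7) + 2"
    have "C > 0" using \<open>0 \<le> t1\<close> by (auto simp: C_def intro!: add_nonneg_pos mult_nonneg_nonneg)
    define e' where "e' = e / (2 * C)"
    have "e' > 0" "C * e' < e" using \<open>e > 0\<close> \<open>C > 0\<close> by (auto simp: e'_def)
    obtain v h0 where "0 < h0"
      and v: "\<And>s. 0 \<le> s \<Longrightarrow> s \<le> t1 \<Longrightarrow> norm (v s - T s y) \<le> 2 * e'"
      and step: "\<And>s h. 0 \<le> s \<Longrightarrow> 0 < h \<Longrightarrow> h < h0 \<Longrightarrow> s + h \<le> t1 \<Longrightarrow>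
        norm (S h (v s) - v (s + h)) \<le> 7 * e' * h"
    proof (rule chernoff_core_step[of "\<lambda>s. T s y" "\<lambda>s. T s z" A S e' t1])
      show "(T s y, T s z) \<in> closure A" if "0 \<le> s" for s
        using generator_invariant[OF T yz that] gen by auto
      show "((\<lambda>s. T s y) has_vector_derivative T s z) (at s within {0..})" if "0 \<le> s" for s
        using generator_has_vector_derivative[OF T yz that] .
      show "continuous_on {0..} (\<lambda>s. T s z)" using C0_semigroupD(3)[OF T] .
    qed (use lin cons \<open>e' > 0\<close> \<open>0 \<le> t1\<close> in auto)
    \<comment> \<open>Such \<open>n\<close> make the step \<open>t / real n\<close> smaller than
      \<open>h0\<close> for all \<open>t\<close> in \<open>{0..t1}\<close> at once, which gives
      uniformity in \<open>t\<close>.\<close>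
    have "\<forall>\<^sub>F n in sequentially. t1 / h0 < real n" by real_asymp
    then show "\<forall>\<^sub>F n in sequentially. \<forall>t\<in>{0..t1}. dist ((S (t / real n) ^^ n) y) (T t y) < e"
    proof eventually_elim
      case (elim n)
      have n: "0 < real n" using elim \<open>0 \<le> t1\<close> \<open>0 < h0\<close> by (meson divide_nonneg_pos le_less_trans)
      show ?case
      proof
        fix t assume t: "t \<in> {0..t1}"
        show "dist ((S (t / real n) ^^ n) y) (T t y) < e"
        proof (cases "t = 0")
          case True
          have "S 0 = id" using zero by auto
          then show ?thesis using True C0_semigroupD(1)[OF T] \<open>e > 0\<close> by simp
        next
          case False
          define h where "h = t / real n"
          have h: "0 < h" "h < h0" "real n * h = t"
          proof -
            have "t < h0 * real n" using t elim \<open>0 < h0\<close> by (simp add: field_simps)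
            then show "h < h0" using n by (simp add: h_def field_simps)
          qed (use t False n in \<open>auto simp: h_def\<close>)
          have "norm ((S h ^^ n) y - v (real n * h)) \<le> (1 + w * h) ^ n * (2 * e' + real n * (7 * e' * h))"
          proof (rule approximation_error)
            show "norm (y - v (real 0 * h)) \<le> 2 * e'"
              using v[of 0] \<open>0 \<le> t1\<close> C0_semigroupD(1)[OF T] by (simp add: norm_minus_commute)
            show "norm (S h (v (real k * h)) - v (real (Suc k) * h)) \<le> 7 * e' * h" if "k < n" for k
            proof -
              have "real (Suc k) * h \<le> real n * h" using that h by (intro mult_right_mono) auto
              then have "real k * h + h \<le> t1" using t h(3) by (simp add: algebra_simps)
              then show ?thesis using step[of "real k * h" h] h by (simp add: algebra_simps)
            qed
          qed (use h lin bound \<open>0 \<le> w\<close> in auto)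
          also have "2 * e' + real n * (7 * e' * h) = e' * (2 + t * 7)" using h(3) by (simp add: algebra_simps)
          also have "(1 + w * h) ^ n * (e' * (2 + t * 7)) \<le> exp (w * t1) * (e' * (2 + t1 * 7))"
          proof (intro mult_mono)
            have "(1 + w * h) ^ n \<le> exp (w * t)" unfolding h_def
              using t \<open>0 \<le> w\<close> by (intro one_plus_power_le_exp) auto
            also have "\<dots> \<le> exp (w * t1)" using t \<open>0 \<le> w\<close> by (simp add: mult_left_mono)
            finally show "(1 + w * h) ^ n \<le> exp (w * t1)" .
          qed (use t \<open>e' > 0\<close> in auto)
          finally have "norm ((S h ^^ n) y - v t) \<le> exp (w * t1) * (e' * (2 + t1 * 7))" using h(3) by simp
          moreover have "norm (v t - T t y) \<le> 2 * e'" using v t by auto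
          ultimately have "norm ((S h ^^ n) y - T t y) \<le> C * e'"
            using norm_triangle_ineq[of "(S h ^^ n) y - v t" "v t - T t y"]
            by (simp add: C_def algebra_simps)
          then show ?thesis using \<open>C * e' < e\<close> by (simp add: dist_norm h_def)
        qed
      qed
    qed
  qed
  \<comment> \<open>A bound for \<open>T\<close> that is uniform in \<open>t\<close> is obtained
    here without the uniform boundedness principle: the bound on the products passes to their limit,
    and afterwards to all vectors by density.\<close>
  have T_domain: "norm (T t y) \<le> exp (w * t0) * norm y" if "(y, z) \<in> generator T" "t \<in> {0..t0}" for y z t
  proof (rule tendsto_upperbound[OF tendsto_norm])
    show "(\<lambda>n. (S (t / real n) ^^ n) y) \<longlonglongrightarrow> T t y"
      using tendsto_uniform_limitI[OF on_domain[OF that(1) \<open>0 \<le> t0\<close>] that(2)] .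
    show "\<forall>\<^sub>F n in sequentially. norm ((S (t / real n) ^^ n) y) \<le> exp (w * t0) * norm y"
      using that by (intro always_eventually allI bound_iter) auto
  qed simp
  have T_bound: "norm (T t y) \<le> exp (w * t0) * norm y" if "t \<in> {0..t0}" for y t
  proof -
    have "\<exists>p. (\<exists>q. (p, q) \<in> generator T) \<and> norm (y - p) < inverse (real (Suc k))" for k
      using generator_dense[OF T, of "inverse (real (Suc k))" y] by (metis inverse_positive_iff_positive of_nat_0_less_iff zero_less_Suc)
    then obtain p where p: "\<And>k. \<exists>q. (p k, q) \<in> generator T" "\<And>k. norm (y - p k) < inverse (real (Suc k))"
      by metis
    have "(\<lambda>k. norm (p k - y)) \<longlonglongrightarrow> 0"
      using p(2) by (intro tendsto_sandwich[OF _ _ tendsto_const LIMSEQ_inverse_real_of_nat])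
        (auto simp: norm_minus_commute less_imp_le)
    then have "p \<longlonglongrightarrow> y" by (simp add: tendsto_norm_zero_iff LIM_zero_iff)
    then have "(\<lambda>k. norm (T t (p k))) \<longlonglongrightarrow> norm (T t y)" "(\<lambda>k. exp (w * t0) * norm (p k)) \<longlonglongrightarrow> exp (w * t0) * norm y"
      by (auto intro!: tendsto_intros)
    then show ?thesis
    proof (rule LIMSEQ_le)
      show "\<exists>N. \<forall>k\<ge>N. norm (T t (p k)) \<le> exp (w * t0) * norm (p k)"
        using T_domain[OF _ that] p(1) by blast
    qed
  qed
  show ?thesis
  proof (rule uniform_limitI)
    fix e :: real assume "e > 0"
    define C where "C = exp (w * t0)"
    have "C > 0" by (simp add: C_def)
    \<comment> \<open>Thirds: replacing \<open>x\<close> by \<open>y\<close> costs at most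
      \<open>C * e'\<close> in the products and again in \<open>T\<close>; the last third is the
      convergence at \<open>y\<close>.\<close>
    define e' where "e' = e / (3 * C)"
    have "e' > 0" "C * e' = e / 3" using \<open>e > 0\<close> \<open>C > 0\<close> by (auto simp: e'_def)
    obtain y z where yz: "(y, z) \<in> generator T" "norm (x - y) < e'"
      using generator_dense[OF T \<open>e' > 0\<close>] .
    then have small: "C * norm (x - y) \<le> e / 3"
      using \<open>C > 0\<close> \<open>C * e' = e / 3\<close> by (metis less_imp_le mult_left_mono)
    have "\<forall>\<^sub>F n in sequentially. \<forall>t\<in>{0..t0}. dist ((S (t / real n) ^^ n) y) (T t y) < e / 3"
      using on_domain[OF yz(1) \<open>0 \<le> t0\<close>] by (rule uniform_limitD) (use \<open>e > 0\<close> in simp)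
    then show "\<forall>\<^sub>F n in sequentially. \<forall>t\<in>{0..t0}. dist ((S (t / real n) ^^ n) x) (T t x) < e"
    proof eventually_elim
      case (elim n)
      show ?case
      proof
        fix t assume t: "t \<in> {0..t0}"
        let ?P = "S (t / real n) ^^ n"
        have "norm (?P x - ?P y) \<le> e / 3"
          using bound_iter[of t t0 n "x - y"] t small linear_diff[OF linear_funpow[OF lin], of "t / real n" n x y]
          by (simp add: C_def)
        moreover have "norm (T t y - T t x) \<le> e / 3"
          using T_bound[OF t, of "y - x"] small by (simp add: C_def blinfun.diff_right norm_minus_commute)
        moreover have "norm (?P y - T t y) < e / 3" using elim t by (simp add: dist_norm)
        ultimately show "dist (?P x) (T t x) < e"
          using norm_triangle_ineq[of "?P x - ?P y" "?P y - T t y"]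
            norm_triangle_ineq[of "?P x - T t y" "T t y - T t x"] by (simp add: dist_norm)
      qed
    qed
  qed
qed

subsection \<open>Consistency and stability of the shift operators\<close>

lemma has_real_derivative_line:
  assumes "f differentiable (at (x + s *\<^sub>R v))"
  shows "((\<lambda>s. f (x + s *\<^sub>R v)) has_real_derivative v \<bullet> gradient f (x + s *\<^sub>R v)) (at s)"
proof -
  obtain f' where f': "(f has_derivative f') (at (x + s *\<^sub>R v))"
    using assms unfolding differentiable_def by blast
  have "f' v = f' (\<Sum>j\<in>UNIV. (v $ j) *\<^sub>R axis j 1)"
    by (simp add: basis_expansion[of v, unfolded scalar_mult_eq_scaleR])
  also have "\<dots> = v \<bullet> gradient f (x + s *\<^sub>R v)"
    using has_derivative_linear[OF f']
    by (simp add: linear_sum linear_scale partial_eq_frechet[OF f'] gradient_def inner_vec_def)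
  finally have v: "f' v = v \<bullet> gradient f (x + s *\<^sub>R v)" .
  have "((\<lambda>s. x + s *\<^sub>R v) has_derivative (\<lambda>r. r *\<^sub>R v)) (at s)"
    by (auto intro!: derivative_eq_intros)
  from diff_chain_at[OF this f']
  have "((\<lambda>s. f (x + s *\<^sub>R v)) has_derivative (\<lambda>r. f' (r *\<^sub>R v))) (at s)" by (simp add: o_def)
  then show ?thesis
    unfolding has_field_derivative_def
    by (rule has_derivative_eq_rhs) (simp add: fun_eq_iff linear_scale[OF has_derivative_linear[OF f']] v)
qed

lemma has_real_derivative_axis:
  assumes "f \<in> Cb_infty"
  shows "((\<lambda>s. f (x + s *\<^sub>R axis j 1)) has_real_derivative partial j f (x + s *\<^sub>R axis j 1)) (at s)"
  using has_real_derivative_line[OF Cb_inftyD(1)[OF assms], of x "axis j 1" s]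
  by (simp add: gradient_def inner_axis')

text \<open>The remainder is measured by the oscillation of the gradient near \<open>x\<close>, so
  that uniform continuity makes it small uniformly in \<open>x\<close>. The intermediate point may
  lie on either side of \<open>x\<close>, which the ball in \<open>osc\<close> allows for.\<close>

lemma first_difference_bound:
  assumes f: "f \<in> Cb_infty"
    and osc: "\<And>y. norm (y - x) \<le> norm v \<Longrightarrow> norm (gradient f y - gradient f x) \<le> e"
  shows "\<bar>f (x + v) - f x - v \<bullet> gradient f x\<bar> \<le> norm v * e"
proof -
  have "\<exists>t. \<bar>t\<bar> \<le> \<bar>1\<bar> \<and> f (x + 1 *\<^sub>R v) =
      (\<Sum>m<1. (if m = 0 then f (x + 0 *\<^sub>R v) else v \<bullet> gradient f (x + 0 *\<^sub>R v)) / fact m * 1 ^ m) +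
      (if 1 = (0::nat) then f (x + t *\<^sub>R v) else v \<bullet> gradient f (x + t *\<^sub>R v)) / fact 1 * 1 ^ 1"
    by (rule Maclaurin_bi_le[of "\<lambda>m s. if m = 0 then f (x + s *\<^sub>R v) else v \<bullet> gradient f (x + s *\<^sub>R v)"
          "\<lambda>s. f (x + s *\<^sub>R v)" 1 1])
      (auto intro: has_real_derivative_line Cb_inftyD f)
  then obtain t :: real where t: "\<bar>t\<bar> \<le> 1" "f (x + v) = f x + v \<bullet> gradient f (x + t *\<^sub>R v)"
    by auto
  have "f (x + v) - f x - v \<bullet> gradient f x = v \<bullet> (gradient f (x + t *\<^sub>R v) - gradient f x)"
    using t(2) by (simp add: inner_diff_right)
  also have "\<bar>\<dots>\<bar> \<le> norm v * norm (gradient f (x + t *\<^sub>R v) - gradient f x)"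
    by (rule Cauchy_Schwarz_ineq2)
  also have "\<dots> \<le> norm v * e"
    using t(1) mult_right_mono[of "\<bar>t\<bar>" 1 "norm v"] by (intro mult_left_mono osc) auto
  finally show ?thesis .
qed

text \<open>The symmetrised function \<open>f (x + s e) + f (x - s e)\<close> is even in
  \<open>s\<close>, so its expansion to second order has no linear term, and its remainder is an
  average of the second derivative at two points within distance \<open>\<bar>r\<bar>\<close> of
  \<open>x\<close>.\<close>

lemma second_difference_bound:
  assumes f: "f \<in> Cb_infty"
    and osc: "\<And>y. norm (y - x) \<le> \<bar>r\<bar> \<Longrightarrow> \<bar>partial j (partial j f) y - partial j (partial j f) x\<bar> \<le> e"
  shows "\<bar>f (x + r *\<^sub>R axis j 1) + f (x - r *\<^sub>R axis j 1) - 2 * f x - r\<^sup>2 * partial j (partial j f) x\<bar> \<le> r\<^sup>2 * e"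
proof -
  let ?p = "\<lambda>s. x + s *\<^sub>R axis j (1::real)"
  \<comment> \<open>The successive derivatives in \<open>s\<close> of the symmetrised function; each
    differentiation flips the sign of the reflected term.\<close>
  let ?g = "\<lambda>(m::nat) s. if m = 0 then f (?p s) + f (?p (- s))
    else if m = 1 then partial j f (?p s) - partial j f (?p (- s))
    else partial j (partial j f) (?p s) + partial j (partial j f) (?p (- s))"
  have neg: "((\<lambda>s. g (x - s *\<^sub>R axis j 1)) has_real_derivative - partial j g (x - s *\<^sub>R axis j 1)) (at s)" if "g \<in> Cb_infty" for g s
    using has_real_derivative_axis[OF that, of x j "- s"] unfolding DERIV_mirror by simp
  have "\<exists>t. \<bar>t\<bar> \<le> \<bar>r\<bar> \<and> f (?p r) + f (?p (- r)) = (\<Sum>m<2. ?g m 0 / fact m * r ^ m) + ?g 2 t / fact 2 * r ^ 2"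
    by (rule Maclaurin_bi_le)
      (auto simp: less_2_cases_iff
        intro!: derivative_eq_intros has_real_derivative_axis neg f Cb_infty_partial)
  then obtain t where t: "\<bar>t\<bar> \<le> \<bar>r\<bar>" and eq: "f (?p r) + f (?p (- r)) = 2 * f x +
      (partial j (partial j f) (?p t) + partial j (partial j f) (?p (- t))) / 2 * r\<^sup>2"
    by (auto simp: numeral_2_eq_2)
  let ?q = "\<lambda>y. partial j (partial j f) y - partial j (partial j f) x"
  have bounds: "\<bar>?q (?p t)\<bar> \<le> e" "\<bar>?q (?p (- t))\<bar> \<le> e"
    by (rule osc, use t in simp)+
  have half: "\<bar>(p + q) / 2\<bar> \<le> e" if "\<bar>p\<bar> \<le> e" "\<bar>q\<bar> \<le> e" for p q :: real
    using that abs_triangle_ineq[of p q] by simp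
  note mean = half[OF bounds]
  have minus: "x - r *\<^sub>R axis j 1 = ?p (- r)" by simp
  have rearrange: "F - 2 * y - R * D = R * ((P - D + (Q - D)) / 2)" if "F = 2 * y + (P + Q) / 2 * R"
    for F y R D P Q :: real
    using that by (simp add: field_simps)
  have "f (x + r *\<^sub>R axis j 1) + f (x - r *\<^sub>R axis j 1) - 2 * f x - r\<^sup>2 * partial j (partial j f) x =
      r\<^sup>2 * ((?q (?p t) + ?q (?p (- t))) / 2)"
    unfolding minus by (rule rearrange[OF eq])
  then show ?thesis
    by (simp only: abs_mult abs_power2 mult_left_mono[OF mean zero_le_power2])
qed

text \<open>Packing the components into one vector gives a single modulus of continuity for all
  directions \<open>j\<close>.\<close>

lemma Cb_infty_ucont_vec:
  fixes f :: "'n::finite \<Rightarrow> real^'n \<Rightarrow> real"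
  assumes "\<And>j. f j \<in> Cb_infty"
  shows "uniformly_continuous_on UNIV (\<lambda>x. \<chi> j. f j x)"
proof -
  obtain b where "\<And>j. apply_ucbfun (b j) = f j"
    using choice[of "\<lambda>j \<phi>. apply_ucbfun \<phi> = f j"] Cb_infty_ucbfun[OF assms] by blast
  then show ?thesis using ucont_vec[of b] by simp
qed

lemma ucont_normE:
  fixes f :: "'a::real_normed_vector \<Rightarrow> 'b::real_normed_vector"
  assumes "uniformly_continuous_on UNIV f" "0 < e"
  obtains d where "0 < d" "\<And>x y. norm (y - x) < d \<Longrightarrow> norm (f y - f x) < e"
  using assms unfolding uniformly_continuous_on_def dist_norm by blast

text \<open>The constants in \<open>shift_expr\<close> are balanced as follows. The translates carry
  total weight 1/2 + 1/2 = 1. The squared displacement \<open>4 * d * (a j x)\<^sup>2 * h\<close>,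
  with \<open>d\<close> the dimension, against the weight \<open>1 / (4 * d)\<close> leaves
  \<open>h\<close> times the second-order term, and half of the shift by \<open>2 * h\<close> leaves
  \<open>h\<close> times the drift; the term with \<open>c\<close> is exact.\<close>

lemma shift_op_consistent:
  fixes a b :: "'n::finite \<Rightarrow> (real^'n) ucbfun"
  assumes "(\<phi>, \<psi>) \<in> diff_op a b c"
  shows "((\<lambda>h. (shift_op a b c h \<phi> - \<phi>) /\<^sub>R h) \<longlongrightarrow> \<psi>) (at_right 0)"
proof (rule tendstoI)
  fix e :: real assume "e > 0"
  have f: "apply_ucbfun \<phi> \<in> Cb_infty" and \<psi>: "apply_ucbfun \<psi> = diff_expr a b c \<phi>"
    using assms by (auto simp: diff_op_def)
  let ?d = "real CARD('n)" and ?\<beta> = "\<lambda>x. \<chi> j. b j x" and ?D2 = "\<lambda>j. partial j (partial j \<phi>)"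
  define A where "A = (\<Sum>j\<in>UNIV. norm (a j))"
  have A: "\<bar>a j x\<bar> \<le> A" for j x
    using abs_le_norm_ucbfun[of "a j" x] member_le_sum[of j UNIV "\<lambda>j. norm (a j)"]
    by (simp add: A_def)
  then have "0 \<le> A" using abs_ge_zero order_trans by blast
  define B where "B = (\<Sum>j\<in>UNIV. norm (b j))"
  have B: "norm (?\<beta> x) \<le> B" for x
    using norm_le_l1_cart[of "?\<beta> x"] sum_mono[of UNIV "\<lambda>j. \<bar>b j x\<bar>" "\<lambda>j. norm (b j)"]
    by (simp add: B_def abs_le_norm_ucbfun)
  have "0 \<le> B" by (simp add: B_def sum_nonneg)
  \<comment> \<open>The first two summands bound the second-order and the drift remainders per unit
    of \<open>h\<close>; the 1 makes \<open>C\<close> positive, so that one can divide by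
    it.\<close>
  define C where "C = ?d * A\<^sup>2 + B + 1"
  have "C > 0" using \<open>0 \<le> B\<close> by (auto simp: C_def intro!: add_nonneg_pos)
  define e' where "e' = e / (2 * C)"
  have "e' > 0" "C * e' < e" using \<open>e > 0\<close> \<open>C > 0\<close> by (auto simp: e'_def)
  have uc: "uniformly_continuous_on UNIV (gradient \<phi>)"
    unfolding gradient_def by (intro Cb_infty_ucont_vec Cb_infty_partial f)
  obtain d1 where "d1 > 0" and d1: "\<And>x y. norm (y - x) < d1 \<Longrightarrow> norm (gradient \<phi> y - gradient \<phi> x) < e'"
    using ucont_normE[OF uc \<open>e' > 0\<close>] by blast
  have uc2: "uniformly_continuous_on UNIV (\<lambda>x. \<chi> j. ?D2 j x)"
    by (intro Cb_infty_ucont_vec Cb_infty_partial f)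
  obtain d2 where "d2 > 0" and d2: "\<And>x y. norm (y - x) < d2 \<Longrightarrow> norm ((\<chi> j. ?D2 j y) - (\<chi> j. ?D2 j x)) < e'"
    using ucont_normE[OF uc2 \<open>e' > 0\<close>] by blast
  \<comment> \<open>Since the coefficients are bounded, these majorants of the displacements do not
    depend on \<open>x\<close>; once they are below \<open>d2\<close> and \<open>d1\<close>, the
    oscillation bounds apply at every \<open>x\<close>.\<close>
  have "((\<lambda>h. 2 * sqrt ?d * A * sqrt h) \<longlongrightarrow> 2 * sqrt ?d * A * sqrt 0) (at_right 0)"
    "((\<lambda>h. 2 * h * B) \<longlongrightarrow> 2 * 0 * B) (at_right 0)"
    by (intro tendsto_intros)+
  then have "\<forall>\<^sub>F h in at_right 0. 2 * sqrt ?d * A * sqrt h < d2" "\<forall>\<^sub>F h in at_right 0. 2 * h * B < d1"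
    using \<open>d1 > 0\<close> \<open>d2 > 0\<close> by (auto elim!: order_tendstoD)
  then show "\<forall>\<^sub>F h in at_right 0. dist ((shift_op a b c h \<phi> - \<phi>) /\<^sub>R h) \<psi> < e"
    using eventually_at_right_less[of "0::real"]
  proof eventually_elim
    case (elim h)
    have "norm ((shift_op a b c h \<phi> - \<phi>) /\<^sub>R h - \<psi>) \<le> C * e'"
    proof (rule norm_ucbfun_le)
      fix x
      define r where "r j = 2 * sqrt ?d * a j x * sqrt h" for j
      define P where "P j = \<phi> (x + r j *\<^sub>R axis j 1) + \<phi> (x - r j *\<^sub>R axis j 1) - 2 * \<phi> x - (r j)\<^sup>2 * ?D2 j x" for j
      define Q where "Q = \<phi> (x + (2 * h) *\<^sub>R ?\<beta> x) - \<phi> x - ((2 * h) *\<^sub>R ?\<beta> x) \<bullet> gradient \<phi> x"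
      have r2: "(r j)\<^sup>2 = 4 * ?d * (a j x)\<^sup>2 * h" for j
        using elim by (simp add: r_def power_mult_distrib)
      have "\<bar>r j\<bar> < d2" for j
      proof -
        have "\<bar>r j\<bar> = 2 * sqrt ?d * \<bar>a j x\<bar> * sqrt h" using elim by (simp add: r_def abs_mult)
        also have "\<dots> \<le> 2 * sqrt ?d * A * sqrt h"
          using A elim by (intro mult_right_mono mult_left_mono) auto
        finally show ?thesis using elim by simp
      qed
      then have "\<bar>?D2 j y - ?D2 j x\<bar> \<le> e'" if "norm (y - x) \<le> \<bar>r j\<bar>" for j y
      proof -
        have "\<bar>?D2 j y - ?D2 j x\<bar> \<le> norm ((\<chi> j. ?D2 j y) - (\<chi> j. ?D2 j x))"
          using component_le_norm_cart[of "(\<chi> j. ?D2 j y) - (\<chi> j. ?D2 j x)" j] by simp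
        also have "\<dots> \<le> e'"
          using that \<open>\<bar>r j\<bar> < d2\<close> by (intro less_imp_le[OF d2]) linarith
        finally show ?thesis .
      qed
      then have "\<bar>P j\<bar> \<le> (r j)\<^sup>2 * e'" for j
        unfolding P_def by (intro second_difference_bound f)
      also have "(r j)\<^sup>2 * e' \<le> 4 * ?d * h * (A\<^sup>2 * e')" for j
      proof -
        have "(a j x)\<^sup>2 \<le> A\<^sup>2" using A[of j x] by (simp add: abs_le_square_iff[symmetric])
        then have "4 * ?d * h * ((a j x)\<^sup>2 * e') \<le> 4 * ?d * h * (A\<^sup>2 * e')"
          using elim \<open>e' > 0\<close> by (intro mult_left_mono mult_right_mono) auto
        then show ?thesis unfolding r2 by (simp add: mult_ac)
      qed
      finally have P: "\<bar>P j\<bar> \<le> 4 * ?d * h * (A\<^sup>2 * e')" for j .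
      have v: "norm ((2 * h) *\<^sub>R ?\<beta> x) \<le> 2 * h * B"
        using B[of x] elim by (simp add: mult_left_mono)
      then have "\<bar>Q\<bar> \<le> norm ((2 * h) *\<^sub>R ?\<beta> x) * e'"
        unfolding Q_def by (intro first_difference_bound f less_imp_le[OF d1]) (use elim(2) in linarith)
      also have "\<dots> \<le> 2 * h * B * e'" using v \<open>e' > 0\<close> by (intro mult_right_mono) auto
      finally have Q: "\<bar>Q\<bar> \<le> 2 * h * B * e'" .
      \<comment> \<open>Everything up to order \<open>h\<close> cancels, and only the two kinds of
        Taylor remainder are left.\<close>
      have "shift_expr a b c h \<phi> x - \<phi> x - h * diff_expr a b c \<phi> x = 1 / (4 * ?d) * (\<Sum>j\<in>UNIV. P j) + Q / 2"
      proof -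
        have "(\<Sum>j\<in>UNIV. P j) = (\<Sum>j\<in>UNIV. \<phi> (x + r j *\<^sub>R axis j 1) + \<phi> (x - r j *\<^sub>R axis j 1))
            - 2 * ?d * \<phi> x - 4 * ?d * h * (\<Sum>j\<in>UNIV. (a j x)\<^sup>2 * ?D2 j x)"
          by (simp add: P_def r2 sum_subtractf sum_distrib_left mult_ac)
        then show ?thesis
          unfolding shift_expr_def diff_expr_def r_def[symmetric] Q_def by (simp add: field_simps)
      qed
      also have "\<bar>\<dots>\<bar> \<le> h * (C * e')"
      proof -
        have "\<bar>\<Sum>j\<in>UNIV. P j\<bar> \<le> ?d * (4 * ?d * h * (A\<^sup>2 * e'))"
          using P by (intro order_trans[OF sum_abs] sum_bounded_above) auto
        then have "\<bar>1 / (4 * ?d) * (\<Sum>j\<in>UNIV. P j)\<bar> \<le> 1 / (4 * ?d) * (?d * (4 * ?d * h * (A\<^sup>2 * e')))"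
          unfolding abs_mult by (intro mult_mono) auto
        also have "\<dots> = h * (?d * A\<^sup>2 * e')" by simp
        finally have 1: "\<bar>1 / (4 * ?d) * (\<Sum>j\<in>UNIV. P j)\<bar> \<le> h * (?d * A\<^sup>2 * e')" .
        have "\<bar>Q / 2\<bar> \<le> h * B * e'" using Q by simp
        moreover have "0 \<le> h * e'" using elim(3) \<open>e' > 0\<close> by simp
        moreover have "h * (C * e') = h * (?d * A\<^sup>2 * e') + h * B * e' + h * e'"
          by (simp add: C_def algebra_simps)
        ultimately show ?thesis
          using 1 abs_triangle_ineq[of "1 / (4 * ?d) * (\<Sum>j\<in>UNIV. P j)" "Q / 2"] by linarith
      qed
      finally have "\<bar>shift_expr a b c h \<phi> x - \<phi> x - h * diff_expr a b c \<phi> x\<bar> / h \<le> C * e'"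
        using elim(3) by (simp add: pos_divide_le_eq mult.commute)
      moreover have "apply_ucbfun ((shift_op a b c h \<phi> - \<phi>) /\<^sub>R h - \<psi>) x =
          (shift_expr a b c h \<phi> x - \<phi> x - h * diff_expr a b c \<phi> x) / h"
        using elim(3) by (simp add: shift_op.rep_eq \<psi> field_simps)
      ultimately show "\<bar>apply_ucbfun ((shift_op a b c h \<phi> - \<phi>) /\<^sub>R h - \<psi>) x\<bar> \<le> C * e'"
        using elim(3) by (simp only: abs_divide abs_of_pos)
    qed
    then show ?case using \<open>C * e' < e\<close> by (simp add: dist_norm)
  qed
qed

text \<open>The translates enter with nonnegative weights of sum 1 and cannot increase the sup norm;
  only the term with \<open>c\<close> contributes growth. The factor \<open>1 + norm c * t\<close>
  is what keeps the iterated products bounded.\<close>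

lemma norm_shift_op_le:
  fixes a b :: "'n::finite \<Rightarrow> (real^'n) ucbfun"
  assumes "0 \<le> t"
  shows "norm (shift_op a b c t f) \<le> (1 + norm c * t) * norm f"
proof (rule norm_ucbfun_le)
  fix x
  let ?d = "real CARD('n)"
  let ?r = "\<lambda>j. 2 * sqrt ?d * a j x * sqrt t"
  let ?s = "\<Sum>j\<in>UNIV. f (x + ?r j *\<^sub>R axis j 1) + f (x - ?r j *\<^sub>R axis j 1)"
  note le = abs_le_norm_ucbfun[of f]
  have "\<bar>f (x + ?r j *\<^sub>R axis j 1) + f (x - ?r j *\<^sub>R axis j 1)\<bar> \<le> 2 * norm f" for j
    using le[of "x + ?r j *\<^sub>R axis j 1"] le[of "x - ?r j *\<^sub>R axis j 1"] by linarith
  then have "\<bar>?s\<bar> \<le> ?d * (2 * norm f)"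
    by (intro order_trans[OF sum_abs] sum_bounded_above) auto
  then have "\<bar>1 / (4 * ?d) * ?s\<bar> \<le> 1 / (4 * ?d) * (?d * (2 * norm f))"
    unfolding abs_mult by (intro mult_mono) auto
  also have "\<dots> = norm f / 2" by simp
  finally have "\<bar>1 / (4 * ?d) * ?s\<bar> \<le> norm f / 2" .
  moreover have "\<bar>1 / 2 * f (x + (2 * t) *\<^sub>R (\<chi> j. b j x))\<bar> \<le> norm f / 2"
    using le[of "x + (2 * t) *\<^sub>R (\<chi> j. b j x)"] by simp
  moreover have "\<bar>t * c x * f x\<bar> \<le> t * norm c * norm f"
    using assms le[of x] abs_le_norm_ucbfun[of c x] unfolding abs_mult by (intro mult_mono) auto
  moreover have "(1 + norm c * t) * norm f = norm f / 2 + norm f / 2 + t * norm c * norm f"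
    by (simp add: algebra_simps)
  ultimately show "\<bar>shift_op a b c t f x\<bar> \<le> (1 + norm c * t) * norm f"
    unfolding shift_op.rep_eq shift_expr_def by linarith
qed

lemma bounded_linear_shift_op:
  fixes a b :: "'n::finite \<Rightarrow> (real^'n) ucbfun"
  assumes "0 \<le> t"
  shows "bounded_linear (shift_op a b c t)"
proof (rule bounded_linear_intro)
  show "shift_op a b c t (f + g) = shift_op a b c t f + shift_op a b c t g" for f g
    by (rule ucbfun_eqI) (simp add: shift_op.rep_eq shift_expr_def sum.distrib algebra_simps)
  show "shift_op a b c t (r *\<^sub>R f) = r *\<^sub>R shift_op a b c t f" for r f
    by (rule ucbfun_eqI) (simp add: shift_op.rep_eq shift_expr_def sum_distrib_left sum.distrib algebra_simps)
  show "norm (shift_op a b c t f) \<le> norm f * (1 + norm c * t)" for f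
    using norm_shift_op_le[OF assms] by (simp add: mult.commute)
qed

lemma shift_op_zero: "shift_op a b c 0 f = f" for a b :: "'n::finite \<Rightarrow> (real^'n) ucbfun"
  by (rule ucbfun_eqI) (simp add: shift_op.rep_eq shift_expr_def)

section \<open>The Cauchy problem and the product formula for the shift operators\<close>

theorem theorem3:
  fixes a b :: "'n::finite \<Rightarrow> (real^'n) ucbfun" and c :: "(real^'n) ucbfun"
    and T :: "real \<Rightarrow> (real^'n) ucbfun \<Rightarrow>\<^sub>L (real^'n) ucbfun"
  assumes "closable (diff_op a b c)"
    and "C0_semigroup T"
    and "generator T = closure (diff_op a b c)"
  shows "(\<forall>t\<ge>0. bounded_linear (shift_op a b c t)) \<and>
    (\<exists>u :: (real^'n) ucbfun \<Rightarrow> real \<Rightarrow> real^'n \<Rightarrow> real. \<forall>u0.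
      solves_cauchy_problem a b c u0 (u u0) \<and>
      (\<forall>t0>0. bounded ((\<lambda>(t, x). u u0 t x) ` ({0..t0} \<times> UNIV))) \<and>
      (\<forall>t\<ge>0. uniformly_continuous_on UNIV (u u0 t)) \<and>
      (\<forall>t\<ge>0. uniform_limit UNIV (\<lambda>v. u v t) (u u0 t) (at u0)) \<and>
      (\<forall>t\<ge>0. \<forall>x. u u0 t x = T t u0 x \<and>
        (\<lambda>n. (shift_op a b c (t / real n) ^^ n) u0 x) \<longlonglongrightarrow> u u0 t x) \<and>
      (\<forall>t>0. (\<lambda>n. (shift_op a b c (t / real n) ^^ n) u0) \<longlonglongrightarrow> T t u0) \<and>
      (\<forall>t0>0. uniform_limit {0..t0}
        (\<lambda>n t. (shift_op a b c (t / real n) ^^ n) u0) (\<lambda>t. T t u0) sequentially))"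
proof (intro conjI exI[of _ "\<lambda>u0 t. apply_ucbfun (T t u0)"] allI impI)
  fix t :: real assume "0 \<le> t"
  then show "bounded_linear (shift_op a b c t)" by (rule bounded_linear_shift_op)
next
  note T = assms(2) and gen = assms(3)
  fix u0 :: "(real^'n) ucbfun"
  have cont: "continuous_on {0..} (\<lambda>t. T t v)" for v using C0_semigroupD(3)[OF T] .
  \<comment> \<open>Chernoff's formula with \<open>diff_op a b c\<close> as core and growth rate
    \<open>norm c\<close>.\<close>
  have limit: "uniform_limit {0..t0}
      (\<lambda>n t. (shift_op a b c (t / real n) ^^ n) u0) (\<lambda>t. T t u0) sequentially" if "0 \<le> t0" for t0
  proof (rule chernoff[OF T])
    show "generator T \<subseteq> closure (diff_op a b c)" using gen by simp
    show "linear (shift_op a b c h)" if "0 \<le> h" for h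
      using bounded_linear_shift_op[OF that] by (rule bounded_linear.linear)
    show "norm (shift_op a b c h f) \<le> (1 + norm c * h) * norm f" if "0 \<le> h" for h f
      using that by (rule norm_shift_op_le)
    show "((\<lambda>h. (shift_op a b c h f - f) /\<^sub>R h) \<longlongrightarrow> g) (at_right 0)"
      if "(f, g) \<in> diff_op a b c" for f g
      using that by (rule shift_op_consistent)
  qed (use that in \<open>auto simp: shift_op_zero\<close>)
  have pointwise: "(\<lambda>n. (shift_op a b c (t / real n) ^^ n) u0) \<longlonglongrightarrow> T t u0" if "0 \<le> t" for t
    using tendsto_uniform_limitI[OF limit[OF that], of t] that by simp
  show "solves_cauchy_problem a b c u0 (\<lambda>t. apply_ucbfun (T t u0))"
    unfolding solves_cauchy_problem_def gen[symmetric]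
  proof (intro exI[of _ "\<lambda>t. T t u0"] conjI allI impI)
    show "mild_solution (generator T) u0 (\<lambda>t. T t u0)"
      unfolding mild_solution_def using generator_integral[OF T] cont C0_semigroupD(1)[OF T] by simp
    assume "u0 \<in> Domain (generator T)"
    then obtain v0 where "(u0, v0) \<in> generator T" by blast
    then show "classical_solution (generator T) u0 (\<lambda>t. T t u0)"
      unfolding classical_solution_def
      using generator_invariant[OF T] generator_has_vector_derivative[OF T] cont C0_semigroupD(1)[OF T]
      by (intro conjI exI[of _ "\<lambda>t. T t v0"]) auto
  qed simp
  show "bounded ((\<lambda>(t, x). T t u0 x) ` ({0..t0} \<times> UNIV))" if "0 < t0" for t0
  proof -
    \<comment> \<open>Boundedness on \<open>{0..t0}\<close> in time is read off from compactness of
      the piece of orbit; the sup norm makes it uniform in \<open>x\<close>.\<close>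
    have "bounded ((\<lambda>t. T t u0) ` {0..t0})"
      by (intro compact_imp_bounded compact_continuous_image continuous_on_subset[OF cont]) auto
    then obtain K where "\<And>t. t \<in> {0..t0} \<Longrightarrow> norm (T t u0) \<le> K" unfolding bounded_iff by blast
    then show ?thesis
      unfolding bounded_iff by (intro exI[of _ K]) (auto intro: order_trans[OF abs_le_norm_ucbfun])
  qed
  show "uniform_limit UNIV (\<lambda>v. apply_ucbfun (T t v)) (apply_ucbfun (T t u0)) (at u0)" for t
  proof (rule uniform_limitI)
    fix e :: real assume "e > 0"
    \<comment> \<open>\<open>T t\<close> is continuous as a bounded operator, and convergence in the
      norm of the space is uniform convergence in \<open>x\<close>.\<close>
    have "((\<lambda>v. T t v) \<longlongrightarrow> T t u0) (at u0)" by (intro tendsto_intros)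
    then have "\<forall>\<^sub>F v in at u0. dist (T t v) (T t u0) < e" using \<open>e > 0\<close> by (rule tendstoD)
    then show "\<forall>\<^sub>F v in at u0. \<forall>x\<in>UNIV. dist (T t v x) (T t u0 x) < e"
    proof eventually_elim
      case (elim v)
      show ?case
        using abs_le_norm_ucbfun[of "T t v - T t u0"] elim
        by (auto simp: dist_norm intro: le_less_trans)
    qed
  qed
  show "(\<lambda>n. (shift_op a b c (t / real n) ^^ n) u0 x) \<longlonglongrightarrow> T t u0 x" if "0 \<le> t" for t x
    using bounded_linear.tendsto[OF bounded_linear_apply_ucbfun pointwise[OF that]] .
  show "(\<lambda>n. (shift_op a b c (t / real n) ^^ n) u0) \<longlonglongrightarrow> T t u0" if "0 < t" for t
    using pointwise that by simp
  show "uniform_limit {0..t0}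
      (\<lambda>n t. (shift_op a b c (t / real n) ^^ n) u0) (\<lambda>t. T t u0) sequentially" if "0 < t0" for t0
    using limit that by simp
qed (rule ucont_apply_ucbfun refl)+

end
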